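(* Consider the strong-only training procedure described in the context. Assume: (A1) (realizability) there is a measurable map $\eta^*:\mathcal X\to\mathbb R^K$ with $P^*(\xi=z_k\mid x)=\operatorname{softmax}_k(\eta^*(x))$ for all $k\in[K]$, with $\eta^*(x)^\top\mathbf 1=0$ for all $x$, and $\mathbb E_x\|\eta^*(x)\|_2^4<\infty$; (A2) (cost) $\mu I\preceq\nabla_a^2c(a,z_k)\preceq LI$ for all $a\in\mathcal A=\mathbb R^d$, $k\in[K]$ (with $0<\mu\le L$), and $\|\nabla_a c(a,z_k)\|_2\le G$ for all $k\in[K]$ and all $a\in\operatorname{conv}\{\tilde w(p):p\in\Delta(\Xi)\}$; (1) there exists $\gamma>0$ such that, almost surely, for all $x\in\mathcal X$, $$\big\|\tilde w(P^{\mathrm s}_{\widehat\Theta_{\mathrm s}}(x))-\tilde w(P^*(x))\big\|_2\ge\gamma\big\|P^{\mathrm s}_{\widehat\Theta_{\mathrm s}}(x)-P^*(x)\big\|_2,$$ and there exists $B_\eta>0$ such that (almost surely, for all $x$) $\|\widehat\Theta_{\mathrm s}^\top\phi_{\mathrm s}(x)\|_\infty\le B_\eta$ and $\|\eta^*(x)\|_\infty\le B_\eta$; (2) there exists $L_H>0$ such that, almost surely over $\tilde{\mathcal B}$, $$-L_HI_{d_\phi K}\preceq\nabla_\Theta^2\Big[\frac1n\sum_{i=1}^nc\big(\tilde w(P_\Theta^{\mathrm s}(\tilde x_i)),\tilde\xi_i\big)\Big]\preceq L_HI_{d_\phi K}$$ for every $\Theta$ on the line segment connecting $\Theta_{\mathrm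 s}^*$ and $\widehat\Theta_{\mathrm s}$ (in particular the Hessian, viewed as an operator on $\operatorname{vec}(\Theta)\in\mathbb R^{d_\phi K}$, exists there). Then there is a universal constant $C_0>0$ such that $$\mathbb E_{\tilde{\mathcal B}}\big[R(\widehat\pi_{\mathrm s})-R^*\big]\ge C_0\,\mu\gamma^2\frac{e^{-4B_\eta}}{K^2}\left(\rho_{\mathrm s}+\frac{\lambda_{\min}(\Lambda_{\mathrm s})\operatorname{tr}(\Sigma_\varphi)}{L_H^2}\cdot\frac1n\right).$$
   Context: Decision problem: $\Xi=\{z_1,\dots,z_K\}$ is finite, $\Delta(\Xi)$ is the set of probability distributions on $\Xi$ (identified with vectors in $\mathbb R^K$), $\mathcal X\subseteq\mathbb R^{d_x}$, the action set is $\mathcal A=\mathbb R^d$, and $c:\mathcal A\times\Xi\to\mathbb R$ is a cost, twice differentiable in its first argument. $\mathcal D$ is the joint law of $(x,\xi)\in\mathcal X\times\Xi$, $\mathcal D_x$ its marginal on $x$ ($\mathbb E_x$ is expectation over $x\sim\mathcal D_x$), $P^*(x)=P^*(\cdot\mid x)$ the conditional law of $\xi$ given $x$. For $p\in\Delta(\Xi)$, $\tilde w(p)=\arg\min_{w\in\mathcal A}\mathbb E_{\xi\sim p}[c(w,\xi)]$. For a policy $\pi:\mathcal X\to\mathcal A$, $R(\pi)=\mathbb E_{(x,\xi)\sim\mathcal D}[c(\pi(x),\xi)]$, and $R^*=\mathbb E_{(x,\xi)\sim\mathcal D}[c(\tilde w(P^*(x)),\xi)]$. $\operatorname{softmax}_k(\eta)=e^{\eta_k}/\sum_je^{\eta_j}$.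 Strong features and training: $\phi_{\mathrm s}:\mathcal X\to\mathbb R^{d_\phi}$; for $\Theta\in\mathbb R^{d_\phi\times K}$, $P_\Theta^{\mathrm s}(x)=\operatorname{softmax}(\Theta^\top\phi_{\mathrm s}(x))$. $\Sigma_{\mathrm s}=\mathbb E_x[\phi_{\mathrm s}(x)\phi_{\mathrm s}(x)^\top]=V_{\mathrm s}\Lambda_{\mathrm s}V_{\mathrm s}^\top$ is the reduced spectral decomposition, where $\Lambda_{\mathrm s}$ is diagonal with the positive eigenvalues of $\Sigma_{\mathrm s}$ (so $\lambda_{\min}(\Lambda_{\mathrm s})$ is the smallest positive eigenvalue of $\Sigma_{\mathrm s}$). $\tilde{\mathcal B}=\{(\tilde x_i,\tilde\xi_i)\}_{i=1}^n$ is i.i.d. from $\mathcal D$. The strong-only estimator is $\widehat\Theta_{\mathrm s}\in\arg\min_{\Theta\in\mathbb R^{d_\phi\times K},\,\Theta\mathbf 1=0}\frac1n\sum_{i=1}^nc(\tilde w(P_\Theta^{\mathrm s}(\tilde x_i)),\tilde\xi_i)$ (such a minimizer is assumed to exist almost surely), and $\widehat\pi_{\mathrm s}(x)=\tilde w(P^{\mathrm s}_{\widehat\Theta_{\mathrm s}}(x))$. $\rho_{\mathrm s}=\min_{\Theta\in\mathbb R^{d_\phi\times K},\,\Theta\mathbf 1=0}\mathbb E_x\|\Theta^\top\phi_{\mathrm s}(x)-\eta^*(x)\|_2^2$, with minimizer $\Theta_{\mathrm s}^*$. With $(x,\xi)\sim\mathcal D$, $\varphi=\operatorname{vec}\big(\nabla_\Theta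 c(\tilde w(P_\Theta^{\mathrm s}(x)),\xi)\big|_{\Theta=\Theta_{\mathrm s}^*}\big)\in\mathbb R^{d_\phi K}$ and $\Sigma_\varphi=\operatorname{Var}(\varphi)$ is its covariance matrix. *)

theory Defs
  imports "HOL-Probability.Probability"
begin

(* Conventions.  R^d, R^{d_phi}, R^{d_x} are real^'d, real^'p, real^'x.  The outcome set Xi is the
   finite type 'k, so K = CARD('k); elements of Delta(Xi) and logits are vectors in real^'k, and
   parameters Theta in R^{d_phi x K} have type real^'k^'p.  The inner product of real^'k^'p is the
   Frobenius one, so gradients and Hessians in Theta are those in vec(Theta) up to the isometry vec. *)

section \<open>Gradients and Hessians\<close>

definition grad :: "('a::real_inner \<Rightarrow> real) \<Rightarrow> 'a \<Rightarrow> 'a" where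
  "grad f x = (THE g. GDERIV f x :> g)"

definition has_hessian :: "('a::real_inner \<Rightarrow> real) \<Rightarrow> ('a \<Rightarrow> 'a) \<Rightarrow> 'a \<Rightarrow> bool" where
  "has_hessian f H x \<longleftrightarrow>
     (\<forall>\<^sub>F y in nhds x. GDERIV f y :> grad f y) \<and> (grad f has_derivative H) (at x)"

(* The Loewner order on linear operators; it is only used for Hessians and multiples of the
   identity, which are self-adjoint. *)
definition loewner_le :: "('a::real_inner \<Rightarrow> 'a) \<Rightarrow> ('a \<Rightarrow> 'a) \<Rightarrow> bool" where
  "loewner_le A B \<longleftrightarrow> (\<forall>v. v \<bullet> A v \<le> v \<bullet> B v)"

section \<open>Decision problem\<close>

definition prob_simplex :: "(real^'k) set" where
  "prob_simplex = {p. (\<forall>k. 0 \<le> p $ k) \<and> (\<Sum>k\<in>UNIV. p $ k) = 1}"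

definition softmax :: "real^'k \<Rightarrow> real^'k" where
  "softmax \<eta> = (\<chi> k. exp (\<eta> $ k) / (\<Sum>j\<in>UNIV. exp (\<eta> $ j)))"

definition opt_action :: "(real^'d \<Rightarrow> 'k::finite \<Rightarrow> real) \<Rightarrow> real^'k \<Rightarrow> real^'d" where
  "opt_action c p = arg_min (\<lambda>w. \<Sum>k\<in>UNIV. p $ k * c w k) (\<lambda>_. True)"

definition context_space :: "(real^'x) set \<Rightarrow> (real^'x) measure" where
  "context_space X = restrict_space borel X"

definition marginal_x ::
  "(real^'x) set \<Rightarrow> ((real^'x) \<times> 'k::finite) measure \<Rightarrow> (real^'x) measure" where
  "marginal_x X D = distr D (context_space X) fst"

(* P is a version of the conditional law of the outcome given the context under D. *)
definition conditional_law ::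
  "(real^'x) set \<Rightarrow> ((real^'x) \<times> 'k::finite) measure \<Rightarrow> (real^'x \<Rightarrow> real^'k) \<Rightarrow> bool" where
  "conditional_law X D P \<longleftrightarrow>
     P \<in> borel_measurable (context_space X) \<and>
     (\<forall>x\<in>X. P x \<in> prob_simplex) \<and>
     (\<forall>k. \<forall>A\<in>sets (context_space X).
        measure D (A \<times> {k}) = (LINT x:A|marginal_x X D. P x $ k))"

definition risk ::
  "(real^'d \<Rightarrow> 'k \<Rightarrow> real) \<Rightarrow> ((real^'x) \<times> 'k) measure \<Rightarrow> (real^'x \<Rightarrow> real^'d) \<Rightarrow> real" where
  "risk c D \<pi> = (\<integral>z. c (\<pi> (fst z)) (snd z) \<partial>D)"

section \<open>Strong-only model and training\<close>

definition centered :: "(real^'k^'p) set" where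
  "centered = {\<Theta>. \<Theta> *v 1 = 0}"

definition model :: "(real^'x \<Rightarrow> real^'p) \<Rightarrow> real^'k^'p \<Rightarrow> real^'x \<Rightarrow> real^'k" where
  "model \<phi> \<Theta> x = softmax (transpose \<Theta> *v \<phi> x)"

definition policy ::
  "(real^'d \<Rightarrow> 'k::finite \<Rightarrow> real) \<Rightarrow> (real^'x \<Rightarrow> real^'p) \<Rightarrow> real^'k^'p \<Rightarrow> real^'x \<Rightarrow> real^'d" where
  "policy c \<phi> \<Theta> x = opt_action c (model \<phi> \<Theta> x)"

definition empirical_risk ::
  "(real^'d \<Rightarrow> 'k::finite \<Rightarrow> real) \<Rightarrow> (real^'x \<Rightarrow> real^'p) \<Rightarrow> nat \<Rightarrow>
     (nat \<Rightarrow> (real^'x) \<times> 'k) \<Rightarrow> real^'k^'p \<Rightarrow> real" where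
  "empirical_risk c \<phi> n s \<Theta> =
     (1 / real n) * (\<Sum>i<n. c (policy c \<phi> \<Theta> (fst (s i))) (snd (s i)))"

definition sample_space :: "nat \<Rightarrow> 'z measure \<Rightarrow> (nat \<Rightarrow> 'z) measure" where
  "sample_space n D = Pi\<^sub>M {..<n} (\<lambda>_. D)"

section \<open>Population quantities in the bound\<close>

definition logit_error ::
  "(real^'x) measure \<Rightarrow> (real^'x \<Rightarrow> real^'p) \<Rightarrow> (real^'x \<Rightarrow> real^'k) \<Rightarrow> real^'k^'p \<Rightarrow> real" where
  "logit_error Dx \<phi> \<eta> \<Theta> = (\<integral>x. (norm (transpose \<Theta> *v \<phi> x - \<eta> x))\<^sup>2 \<partial>Dx)"

definition approx_error ::
  "(real^'x) measure \<Rightarrow> (real^'x \<Rightarrow> real^'p) \<Rightarrow> (real^'x \<Rightarrow> real^'k) \<Rightarrow> real" where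
  "approx_error Dx \<phi> \<eta> = (INF \<Theta>\<in>centered. logit_error Dx \<phi> \<eta> \<Theta>)"

definition second_moment :: "(real^'x) measure \<Rightarrow> (real^'x \<Rightarrow> real^'p) \<Rightarrow> real^'p^'p" where
  "second_moment Dx \<phi> = (\<chi> i j. \<integral>x. \<phi> x $ i * \<phi> x $ j \<partial>Dx)"

(* The smallest diagonal entry of Lambda in the reduced spectral decomposition A = V Lambda V^T.
   It is unspecified when A has no positive eigenvalue.  For A = second_moment Dx phi this means
   phi = 0 almost surely; in the bound it is then multiplied by a vanishing trace. *)
definition min_pos_eigenvalue :: "real^'n^'n \<Rightarrow> real" where
  "min_pos_eigenvalue A = Min {l. 0 < l \<and> (\<exists>v. v \<noteq> 0 \<and> A *v v = l *\<^sub>R v)}"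

definition vectorize :: "real^'k^'p \<Rightarrow> real^('p \<times> 'k)" where
  "vectorize \<Theta> = (\<chi> ik. \<Theta> $ fst ik $ snd ik)"

definition score ::
  "(real^'d \<Rightarrow> 'k::finite \<Rightarrow> real) \<Rightarrow> (real^'x \<Rightarrow> real^'p) \<Rightarrow> real^'k^'p \<Rightarrow>
     (real^'x) \<times> 'k \<Rightarrow> real^('p \<times> 'k)" where
  "score c \<phi> \<Theta>\<^sub>0 z =
     vectorize (grad (\<lambda>\<Theta>. c (policy c \<phi> \<Theta> (fst z)) (snd z)) \<Theta>\<^sub>0)"

definition covariance_matrix :: "'z measure \<Rightarrow> ('z \<Rightarrow> real^'n) \<Rightarrow> real^'n^'n" where
  "covariance_matrix M f =
     (\<chi> i j. \<integral>z. (f z $ i - (\<integral>y. f y $ i \<partial>M)) * (f z $ j - (\<integral>y. f y $ j \<partial>M)) \<partial>M)"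

(* HOL cannot quantify over the dimension types inside a formula, so an existential over the
   constant in the theorem would let it depend on d, d_phi, d_x and K.  A closed
   real constant is independent of them; the value 1/2 is the strong convexity factor in
   f w - min f >= mu/2 * |w - argmin f|^2. *)
definition C\<^sub>0 :: real where
  "C\<^sub>0 = 1 / 2"

end

theory Submission
  imports Defs
begin

text \<open>Strong convexity of the cost, the separation condition and the slope of softmax on bounded
  centred logits bound the excess risk below by a multiple of the mean squared logit error. Since
  \<open>\<Theta>star\<close> minimizes that error over a subspace, the error of \<open>\<Theta>hat\<close> is at least the approximation
  error plus the second moment of the logits of \<open>\<Delta> = \<Theta>hat - \<Theta>star\<close>. The latter only sees the part \<open>Y\<close> of
  \<open>\<Delta>\<close> orthogonal to the kernel of the feature second moment, and it dominates \<open>\<parallel>Y\<parallel>\<^sup>2\<close> times the smallest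
  positive eigenvalue.

  Almost all samples have features orthogonal to that kernel, so the empirical risk does not change
  along \<open>\<Delta> - Y\<close>. As its gradient vanishes at \<open>\<Theta>hat\<close>, the Hessian bound gives \<open>\<parallel>g\<parallel> \<le> L\<^sub>H \<parallel>Y\<parallel>\<close> for the
  empirical gradient \<open>g\<close> at \<open>\<Theta>star\<close>. Finally, \<open>g\<close> is a mean of \<open>n\<close> independent scores, whose expected
  squared norm is at least the trace of the score covariance divided by \<open>n\<close>.\<close>

section \<open>Gradients, Hessians and strong convexity\<close>

text \<open>\<open>\<Theta>hat\<close> depends on the whole sample, so expectations involving it are
  out of reach. It is eliminated sample by sample: the pointwise bound ends in \<open>g\<close>,
  which evaluates gradients at the deterministic \<open>\<Theta>star\<close>, and independence is
  used for \<open>g\<close> alone. The displacement cannot be handled whole, because the logits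
  carry no information about its kernel part, while a Hessian bound by its full norm would charge
  for that part too. The mean score at \<open>\<Theta>star\<close> need not vanish, since
  \<open>\<Theta>star\<close> minimizes a squared logit error and not the risk; its square is
  discarded, which is why the covariance enters through an inequality. The constant is the product
  of \<mu>/2 from quadratic growth at a minimizer, the square of \<gamma>, and the square of the
  softmax slope exp(-2B)/K. Much of the work secures the objects themselves: actions are minimizers
  defined by choice, second derivatives of the cost need not be continuous, and the score has
  meaning only once the optimal action is differentiable in the logits and the resulting gradients
  are measurable and square integrable.\<close>

lemma GDERIV_unique:
  assumes "GDERIV f x :> D" "GDERIV f x :> E"
  shows "D = E"
proof -
  have "(\<lambda>h. h \<bullet> D) = (\<lambda>h. h \<bullet> E)"
    using assms unfolding gderiv_def by (rule has_derivative_unique)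
  then have "(D - E) \<bullet> D = (D - E) \<bullet> E" by metis
  then have "(D - E) \<bullet> (D - E) = 0" by (simp add: inner_diff_right)
  then show ?thesis by simp
qed

lemma grad_eq:
  assumes "GDERIV f x :> D"
  shows "grad f x = D"
  unfolding grad_def using assms by (blast intro: GDERIV_unique)

lemma GDERIV_sum:
  assumes "\<And>i. i \<in> I \<Longrightarrow> GDERIV (f i) x :> D i"
  shows "GDERIV (\<lambda>x. \<Sum>i\<in>I. f i x) x :> (\<Sum>i\<in>I. D i)"
  using assms unfolding gderiv_def inner_sum_right by (rule has_derivative_sum)

lemma GDERIV_cmult:
  fixes r :: real
  assumes "GDERIV f x :> D"
  shows "GDERIV (\<lambda>x. r * f x) x :> r *\<^sub>R D"
  using GDERIV_mult[OF GDERIV_const[of r x] assms] by simp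

lemma GDERIV_along_line:
  assumes "GDERIV f (x + t *\<^sub>R v) :> g"
  shows "((\<lambda>t. f (x + t *\<^sub>R v)) has_real_derivative (v \<bullet> g)) (at t)"
proof -
  have "((\<lambda>t. x + t *\<^sub>R v) has_derivative (\<lambda>h. h *\<^sub>R v)) (at t)"
    by (auto intro!: derivative_eq_intros)
  from has_derivative_compose[OF this, of f "\<lambda>h. h \<bullet> g"] assms
  show ?thesis unfolding gderiv_def has_field_derivative_def by (simp add: mult_commute_abs)
qed

lemma has_derivative_along_line:
  fixes g :: "'a::real_inner \<Rightarrow> 'a"
  assumes "(g has_derivative H) (at (x + t *\<^sub>R v))"
  shows "((\<lambda>t. g (x + t *\<^sub>R v) \<bullet> w) has_real_derivative (H v \<bullet> w)) (at t)"
proof -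
  have "((\<lambda>t. x + t *\<^sub>R v) has_derivative (\<lambda>h. h *\<^sub>R v)) (at t)"
    by (auto intro!: derivative_eq_intros)
  from has_derivative_compose[OF this assms]
  have "((\<lambda>t. g (x + t *\<^sub>R v) \<bullet> w) has_derivative (\<lambda>h. H (h *\<^sub>R v) \<bullet> w)) (at t)"
    by (rule has_derivative_inner_left)
  moreover have "H (h *\<^sub>R v) = h *\<^sub>R H v" for h
    using assms by (simp add: has_derivative_bounded_linear linear_simps bounded_linear.linear)
  ultimately show ?thesis
    unfolding has_field_derivative_def by (simp add: mult_commute_abs)
qed

text \<open>The difference quotient along \<open>D\<close> itself tends to the squared norm of
  \<open>D\<close> and is at most \<open>M\<close> times that norm.\<close>

lemma GDERIV_lipschitz_bound:
  fixes f :: "'a::real_inner \<Rightarrow> real"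
  assumes D: "GDERIV f x :> D" and "0 \<le> M" and lip: "\<And>y. \<bar>f y - f x\<bar> \<le> M * norm (y - x)"
  shows "norm D \<le> M"
proof -
  have "((\<lambda>t. f (x + t *\<^sub>R D)) has_real_derivative (D \<bullet> D)) (at 0)"
    by (rule GDERIV_along_line) (simp add: D)
  then have lim: "(\<lambda>t. (f (x + t *\<^sub>R D) - f x) / t) \<midarrow>0\<rightarrow> D \<bullet> D"
    by (simp add: DERIV_def)
  have "\<forall>\<^sub>F t in at (0::real). (f (x + t *\<^sub>R D) - f x) / t \<le> M * norm D"
    unfolding eventually_at_filter
  proof (intro always_eventually allI impI)
    fix t :: real assume "t \<noteq> 0"
    have "(f (x + t *\<^sub>R D) - f x) / t \<le> \<bar>f (x + t *\<^sub>R D) - f x\<bar> / \<bar>t\<bar>"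
      by (metis abs_divide abs_ge_self)
    also have "\<dots> \<le> (M * norm (t *\<^sub>R D)) / \<bar>t\<bar>"
      using lip[of "x + t *\<^sub>R D"] by (intro divide_right_mono) auto
    also have "\<dots> = M * norm D" using \<open>t \<noteq> 0\<close> by simp
    finally show "(f (x + t *\<^sub>R D) - f x) / t \<le> M * norm D" .
  qed
  with lim have "D \<bullet> D \<le> M * norm D"
    by (intro tendsto_upperbound[OF lim]) auto
  then have "norm D * norm D \<le> M * norm D"
    by (simp add: power2_norm_eq_inner[symmetric] power2_eq_square)
  then show ?thesis
    using \<open>0 \<le> M\<close> by (cases "D = 0") (auto simp: mult_le_cancel_right)
qed

text \<open>The second difference is the increment of a difference in direction \<open>v\<close>
  over a step \<open>t *\<^sub>R u\<close>. The mean value theorem turns it into a difference of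
  gradients at two points near \<open>x\<close>, and differentiability of \<open>g\<close> at
  \<open>x\<close> alone linearizes both.\<close>

lemma second_difference:
  fixes f :: "'a::real_inner \<Rightarrow> real"
  assumes ev: "\<forall>\<^sub>F y in nhds x. GDERIV f y :> g y" and d: "(g has_derivative H) (at x)"
    and e: "0 < e"
  shows "\<exists>\<delta>>0. \<forall>t. 0 < t \<and> t < \<delta> \<longrightarrow>
    \<bar>f (x + t *\<^sub>R u + t *\<^sub>R v) - f (x + t *\<^sub>R u) - f (x + t *\<^sub>R v) + f x - t\<^sup>2 * (u \<bullet> H v)\<bar> \<le> e * t\<^sup>2"
proof -
  interpret H: bounded_linear H using d by (rule has_derivative_bounded_linear)
  define m where "m = norm u + norm v + 1"
  have m: "m \<ge> 1" "norm u \<le> m" "norm v \<le> m" unfolding m_def by auto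
  \<comment> \<open>Each of two remainders is at most \<open>e' * (t * m)\<close> and gets
    multiplied by \<open>t\<close> and by \<open>norm u \<le> m\<close>; the factor
    \<open>2 * m\<^sup>2\<close> cancels exactly this.\<close>
  define e' where "e' = e / (2 * m\<^sup>2)"
  have e': "0 < e'" using e m unfolding e'_def by auto
  obtain d1 where d1: "d1 > 0" "\<And>y. dist y x < d1 \<Longrightarrow> GDERIV f y :> g y"
    using ev unfolding eventually_nhds_metric by blast
  obtain d2 where d2: "d2 > 0"
    "\<And>y. norm (y - x) < d2 \<Longrightarrow> norm (g y - g x - H (y - x)) \<le> e' * norm (y - x)"
    using d e' unfolding has_derivative_at_alt by blast
  define r where "r w = g (x + w) - g x - H w" for w
  have r: "norm (r w) \<le> e' * norm w" if "norm w < d2" for w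
    using d2(2)[of "x + w"] that by (simp add: r_def)
  define \<delta> where "\<delta> = min d1 d2 / m"
  have "\<bar>f (x + t *\<^sub>R u + t *\<^sub>R v) - f (x + t *\<^sub>R u) - f (x + t *\<^sub>R v) + f x - t\<^sup>2 * (u \<bullet> H v)\<bar> \<le> e * t\<^sup>2"
    if t: "0 < t" "t < \<delta>" for t
  proof -
    have tm: "t * m < d1" "t * m < d2" using t m unfolding \<delta>_def by (auto simp: field_simps)
    have small: "norm (s *\<^sub>R (t *\<^sub>R u) + q *\<^sub>R (t *\<^sub>R v)) \<le> t * m" if "0 \<le> s" "s \<le> 1" "0 \<le> q" "q \<le> 1" for s q
    proof -
      have "norm (s *\<^sub>R (t *\<^sub>R u) + q *\<^sub>R (t *\<^sub>R v)) \<le> s * (t * norm u) + q * (t * norm v)"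
        using that t by (intro order_trans[OF norm_triangle_ineq]) (simp add: abs_mult)
      also have "\<dots> \<le> 1 * (t * norm u) + 1 * (t * norm v)"
        using that t by (intro add_mono mult_right_mono) auto
      also have "\<dots> \<le> t * m" using t unfolding m_def by (simp add: algebra_simps)
      finally show ?thesis .
    qed
    define \<psi> where "\<psi> s = f ((x + t *\<^sub>R v) + s *\<^sub>R (t *\<^sub>R u)) - f (x + s *\<^sub>R (t *\<^sub>R u))" for s
    have der: "(\<psi> has_real_derivative
        (t *\<^sub>R u) \<bullet> g ((x + t *\<^sub>R v) + s *\<^sub>R (t *\<^sub>R u)) - (t *\<^sub>R u) \<bullet> g (x + s *\<^sub>R (t *\<^sub>R u))) (at s)"
      if s: "0 \<le> s" "s \<le> 1" for s
      unfolding \<psi>_def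
    proof (intro DERIV_diff GDERIV_along_line d1(2))
      show "dist ((x + t *\<^sub>R v) + s *\<^sub>R (t *\<^sub>R u)) x < d1"
        using small[OF s, of 1] tm by (simp add: dist_norm algebra_simps)
      show "dist (x + s *\<^sub>R (t *\<^sub>R u)) x < d1"
        using small[OF s, of 0] tm by (simp add: dist_norm)
    qed
    obtain s where s: "0 < s" "s < 1" and eq: "\<psi> 1 - \<psi> 0 = (1 - 0) *
        ((t *\<^sub>R u) \<bullet> g ((x + t *\<^sub>R v) + s *\<^sub>R (t *\<^sub>R u)) - (t *\<^sub>R u) \<bullet> g (x + s *\<^sub>R (t *\<^sub>R u)))"
      using MVT2[OF zero_less_one der] by auto
    define a where "a = s *\<^sub>R (t *\<^sub>R u) + 1 *\<^sub>R (t *\<^sub>R v)"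
    define b where "b = s *\<^sub>R (t *\<^sub>R u) + 0 *\<^sub>R (t *\<^sub>R v)"
    have ab: "norm a \<le> t * m" "norm b \<le> t * m"
      unfolding a_def b_def by (intro small; use s in simp)+
    \<comment> \<open>The points \<open>a\<close> and \<open>b\<close> differ by
      \<open>t *\<^sub>R v\<close>, so the linear parts leave exactly
      \<open>t *\<^sub>R H v\<close>.\<close>
    have diff: "g ((x + t *\<^sub>R v) + s *\<^sub>R (t *\<^sub>R u)) - g (x + s *\<^sub>R (t *\<^sub>R u)) = t *\<^sub>R H v + (r a - r b)"
      unfolding r_def a_def b_def by (simp add: H.add H.scaleR algebra_simps)
    have "\<psi> 1 - \<psi> 0 = t * (u \<bullet> (t *\<^sub>R H v + (r a - r b)))"
      unfolding eq diff[symmetric] by (simp add: inner_diff_right right_diff_distrib)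
    then have "\<psi> 1 - \<psi> 0 - t\<^sup>2 * (u \<bullet> H v) = t * (u \<bullet> (r a - r b))"
      by (simp add: inner_add_right power2_eq_square distrib_left)
    moreover have "\<bar>u \<bullet> (r a - r b)\<bar> \<le> m * (2 * (e' * (t * m)))"
    proof -
      have "norm (r a - r b) \<le> e' * (t * m) + e' * (t * m)"
      proof -
        have "norm (r w) \<le> e' * (t * m)" if "norm w \<le> t * m" for w
          by (rule order_trans[OF r mult_left_mono]) (use that tm e' in linarith)+
        from this[OF ab(1)] this[OF ab(2)] show ?thesis
          using norm_triangle_ineq4[of "r a" "r b"] by linarith
      qed
      then have "norm u * norm (r a - r b) \<le> m * (2 * (e' * (t * m)))"
        using m by (intro mult_mono) (auto simp: mult.commute)
      then show ?thesis by (meson Cauchy_Schwarz_ineq2 order_trans)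
    qed
    then have "\<bar>t * (u \<bullet> (r a - r b))\<bar> \<le> t * (m * (2 * (e' * (t * m))))"
      using t by (simp add: abs_mult)
    moreover have "t * (m * (2 * (e' * (t * m)))) = e * t\<^sup>2"
      using m unfolding e'_def by (simp add: power2_eq_square)
    moreover have "\<psi> 1 - \<psi> 0 = f (x + t *\<^sub>R u + t *\<^sub>R v) - f (x + t *\<^sub>R u) - f (x + t *\<^sub>R v) + f x"
      unfolding \<psi>_def by (simp add: algebra_simps)
    ultimately show ?thesis by simp
  qed
  moreover have "\<delta> > 0" using d1 d2 m unfolding \<delta>_def by auto
  ultimately show ?thesis by blast
qed

text \<open>Second differences are symmetric in the two directions, so no continuity of the second
  derivative is needed.\<close>

lemma hessian_symmetric:
  fixes f :: "'a::real_inner \<Rightarrow> real"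
  assumes "has_hessian f H x"
  shows "u \<bullet> H v = v \<bullet> H u"
proof -
  have "\<bar>u \<bullet> H v - v \<bullet> H u\<bar> \<le> 0 + e" if "e > 0" for e :: real
  proof -
    from assms have ev: "\<forall>\<^sub>F y in nhds x. GDERIV f y :> grad f y" "(grad f has_derivative H) (at x)"
      unfolding has_hessian_def by auto
    have half: "0 < e / 2" using that by simp
    obtain d1 where "d1 > 0" and
      1: "\<And>t. 0 < t \<and> t < d1 \<Longrightarrow> \<bar>f (x + t *\<^sub>R u + t *\<^sub>R v) - f (x + t *\<^sub>R u) - f (x + t *\<^sub>R v) + f x - t\<^sup>2 * (u \<bullet> H v)\<bar> \<le> e/2 * t\<^sup>2"
      using second_difference[OF ev half, of u v] by metis
    obtain d2 where "d2 > 0" and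
      2: "\<And>t. 0 < t \<and> t < d2 \<Longrightarrow> \<bar>f (x + t *\<^sub>R v + t *\<^sub>R u) - f (x + t *\<^sub>R v) - f (x + t *\<^sub>R u) + f x - t\<^sup>2 * (v \<bullet> H u)\<bar> \<le> e/2 * t\<^sup>2"
      using second_difference[OF ev half, of v u] by metis
    define t where "t = min d1 d2 / 2"
    have t: "0 < t" "t < d1" "t < d2" using \<open>d1 > 0\<close> \<open>d2 > 0\<close> unfolding t_def by auto
    have swap: "x + t *\<^sub>R v + t *\<^sub>R u = x + t *\<^sub>R u + t *\<^sub>R v" by simp
    have "\<bar>t\<^sup>2 * (u \<bullet> H v) - t\<^sup>2 * (v \<bullet> H u)\<bar> \<le> e * t\<^sup>2"
      using 1[of t] 2[of t] t unfolding swap by argo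
    then have "t\<^sup>2 * \<bar>u \<bullet> H v - v \<bullet> H u\<bar> \<le> t\<^sup>2 * e"
      by (simp add: abs_mult right_diff_distrib[symmetric] mult.commute[of e])
    then show ?thesis using t by simp
  qed
  then have "\<bar>u \<bullet> H v - v \<bullet> H u\<bar> \<le> 0" by (rule field_le_epsilon)
  then show ?thesis by simp
qed

text \<open>Polarization bounds the bilinear form by values of the quadratic form, so no spectral
  decomposition is involved and the dimension may be infinite.\<close>

lemma self_adjoint_norm_bound:
  fixes H :: "'a::real_inner \<Rightarrow> 'a"
  assumes lin: "linear H" and sym: "\<And>u v. u \<bullet> H v = v \<bullet> H u"
    and lower: "loewner_le (\<lambda>v. (- M) *\<^sub>R v) H" and upper: "loewner_le H (\<lambda>v. M *\<^sub>R v)"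
  shows "norm (H v) \<le> M * norm v"
proof (cases "H v = 0 \<or> v = 0")
  case True
  have "- M * (v \<bullet> v) \<le> M * (v \<bullet> v)"
    using lower upper unfolding loewner_le_def by (metis inner_scaleR_right order_trans)
  then have "v \<noteq> 0 \<Longrightarrow> 0 \<le> M"
    using inner_gt_zero_iff[of v] by (auto simp: zero_le_mult_iff simp del: inner_gt_zero_iff)
  then show ?thesis using True linear_0[OF lin] by (cases "v = 0") auto
next
  case False
  have bd: "4 * (u \<bullet> H w) \<le> 2 * M * (u \<bullet> u + w \<bullet> w)" for u w
  proof -
    have "4 * (u \<bullet> H w) = (u + w) \<bullet> H (u + w) - (u - w) \<bullet> H (u - w)"
      using sym[of u w] by (simp add: linear_add[OF lin] linear_diff[OF lin] inner_add_left inner_add_right inner_diff_left inner_diff_right)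
    also have "\<dots> \<le> M * ((u + w) \<bullet> (u + w)) + M * ((u - w) \<bullet> (u - w))"
    proof -
      have "(u + w) \<bullet> H (u + w) \<le> M * ((u + w) \<bullet> (u + w))"
        using upper unfolding loewner_le_def by (metis inner_scaleR_right)
      moreover have "- M * ((u - w) \<bullet> (u - w)) \<le> (u - w) \<bullet> H (u - w)"
        using lower unfolding loewner_le_def by (metis inner_scaleR_right)
      ultimately show ?thesis by linarith
    qed
    also have "\<dots> = 2 * M * (u \<bullet> u + w \<bullet> w)"
      by (simp add: inner_simps inner_commute algebra_simps)
    finally show ?thesis .
  qed
  \<comment> \<open>\<open>a\<close> rescales \<open>H v\<close> to the norm of \<open>v\<close>,
    which balances the two squares in \<open>bd\<close>.\<close>
  define a where "a = norm v / norm (H v)"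
  have "4 * (a * (norm (H v))\<^sup>2) \<le> 2 * M * (a\<^sup>2 * (norm (H v))\<^sup>2 + (norm v)\<^sup>2)"
    using bd[of "a *\<^sub>R H v" v] by (simp add: power2_norm_eq_inner[symmetric] power_mult_distrib)
  then have "norm v * norm (H v) \<le> norm v * (M * norm v)"
    using False by (simp add: a_def power2_eq_square field_simps)
  then show ?thesis using False by simp
qed

text \<open>Along the segment from \<open>x\<close> to \<open>y\<close>, \<open>h\<close> is
  \<open>f\<close> minus the linear and quadratic terms of the claim; monotonicity of
  \<open>g\<close> says that \<open>h\<close> has nonnegative slope.\<close>

lemma strongly_convex_lower_bound:
  fixes f :: "'a::real_inner \<Rightarrow> real"
  assumes g: "\<And>x. GDERIV f x :> g x"
    and mono: "\<And>x y. \<mu> * (norm (x - y))\<^sup>2 \<le> (g x - g y) \<bullet> (x - y)"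
  shows "f x + g x \<bullet> (y - x) + \<mu> / 2 * (norm (y - x))\<^sup>2 \<le> f y"
proof -
  define v where "v = y - x"
  define h where "h t = f (x + t *\<^sub>R v) - t * (v \<bullet> g x) - \<mu> / 2 * t\<^sup>2 * (norm v)\<^sup>2" for t
  have der: "(h has_real_derivative (v \<bullet> g (x + t *\<^sub>R v) - v \<bullet> g x - \<mu> * t * (norm v)\<^sup>2)) (at t)" for t
    unfolding h_def by (rule derivative_eq_intros GDERIV_along_line g refl | simp)+
  have "h 0 \<le> h 1"
  proof (rule DERIV_nonneg_imp_nondecreasing[where f = h and a = 0 and b = 1])
    fix t :: real assume t: "0 \<le> t" "t \<le> 1"
    have "0 \<le> v \<bullet> g (x + t *\<^sub>R v) - v \<bullet> g x - \<mu> * t * (norm v)\<^sup>2"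
    proof (cases "t = 0")
      case False
      have "\<mu> * (t\<^sup>2 * (norm v)\<^sup>2) \<le> t * ((g (x + t *\<^sub>R v) - g x) \<bullet> v)"
        using mono[of "x + t *\<^sub>R v" x] by (simp add: power_mult_distrib)
      then have "t * (\<mu> * t * (norm v)\<^sup>2) \<le> t * ((g (x + t *\<^sub>R v) - g x) \<bullet> v)"
        by (simp add: power2_eq_square ac_simps)
      with False t show ?thesis by (simp add: inner_diff_left inner_commute[of v] mult.assoc)
    qed simp
    with der show "\<exists>y. DERIV h t :> y \<and> 0 \<le> y" by blast
  qed simp
  then show ?thesis unfolding h_def v_def by (simp add: inner_commute algebra_simps)
qed

lemma GDERIV_minimum:
  assumes g: "GDERIV f x :> g" and min: "\<And>y. f x \<le> f y"
  shows "g = 0"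
proof -
  have "(g \<bullet> g) = 0"
  proof (rule DERIV_local_min[where d = 1])
    show "((\<lambda>t. f (x + t *\<^sub>R g)) has_real_derivative (g \<bullet> g)) (at 0)"
      by (rule GDERIV_along_line) (simp add: g)
  qed (use min in auto)
  then show ?thesis by simp
qed

lemma strongly_convex_minimizer:
  fixes f :: "'a::euclidean_space \<Rightarrow> real"
  assumes g: "\<And>x. GDERIV f x :> g x"
    and mono: "\<And>x y. \<mu> * (norm (x - y))\<^sup>2 \<le> (g x - g y) \<bullet> (x - y)" and "0 < \<mu>"
  obtains m where "\<And>y. f m \<le> f y"
proof -
  \<comment> \<open>Outside this radius the quadratic term outweighs \<open>g 0 \<bullet> y\<close>,
    so \<open>f\<close> is at least \<open>f 0\<close> there and the minimum over the ball is
    global.\<close>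
  define r where "r = 2 * norm (g 0) / \<mu>"
  have r: "0 \<le> r" using \<open>0 < \<mu>\<close> by (simp add: r_def)
  have "continuous_on UNIV f"
    using g unfolding gderiv_def
    by (meson continuous_at_imp_continuous_on has_derivative_continuous)
  then obtain m where m: "m \<in> cball 0 r" "\<And>y. y \<in> cball 0 r \<Longrightarrow> f m \<le> f y"
    using continuous_attains_inf[of "cball 0 r" f] r continuous_on_subset[of UNIV f "cball 0 r"] by auto
  have "f m \<le> f y" for y
  proof (cases "y \<in> cball 0 r")
    case False
    then have y: "r < norm y" by simp
    have "f 0 + g 0 \<bullet> y + \<mu> / 2 * (norm y)\<^sup>2 \<le> f y"
      using strongly_convex_lower_bound[OF g mono, of 0 y] by simp
    moreover have "\<bar>g 0 \<bullet> y\<bar> \<le> norm (g 0) * norm y" by (rule Cauchy_Schwarz_ineq2)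
    moreover have "norm (g 0) * norm y \<le> \<mu> / 2 * norm y * norm y"
      using y \<open>0 < \<mu>\<close> unfolding r_def by (intro mult_right_mono) (auto simp: field_simps)
    ultimately have "f 0 \<le> f y" by (simp add: power2_eq_square)
    moreover have "f m \<le> f 0" using m(2)[of 0] r by simp
    ultimately show ?thesis by linarith
  qed (rule m)
  then show ?thesis by (rule that)
qed

text \<open>Pairing the gradient with the fixed direction \<open>v\<close> gives a scalar function
  along the segment, for which the mean value theorem uses the Hessian only pointwise.\<close>

lemma hessian_strongly_monotone:
  fixes f :: "'a::real_inner \<Rightarrow> real"
  assumes "\<And>a. \<exists>H. (grad f has_derivative H) (at a) \<and> loewner_le (\<lambda>v. \<mu> *\<^sub>R v) H"
  shows "\<mu> * (norm (x - y))\<^sup>2 \<le> (grad f x - grad f y) \<bullet> (x - y)"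
proof -
  obtain H where H: "\<And>a. (grad f has_derivative H a) (at a)" "\<And>a. loewner_le (\<lambda>v. \<mu> *\<^sub>R v) (H a)"
    using assms by metis
  define v where "v = x - y"
  have der: "((\<lambda>t. grad f (y + t *\<^sub>R v) \<bullet> v) has_real_derivative (H (y + t *\<^sub>R v) v \<bullet> v)) (at t)" for t
    by (rule has_derivative_along_line) (rule H)
  obtain t where "grad f (y + 1 *\<^sub>R v) \<bullet> v - grad f (y + 0 *\<^sub>R v) \<bullet> v = (1 - 0) * (H (y + t *\<^sub>R v) v \<bullet> v)"
    using MVT2[OF zero_less_one der] by blast
  moreover have "\<mu> * (norm v)\<^sup>2 \<le> H (y + t *\<^sub>R v) v \<bullet> v"
    using H(2)[of "y + t *\<^sub>R v"] unfolding loewner_le_def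
    by (simp add: power2_norm_eq_inner inner_commute)
  ultimately show ?thesis by (simp add: v_def inner_diff_left)
qed

section \<open>Softmax\<close>

lemma softmax_denominator_pos: "0 < (\<Sum>j\<in>UNIV. exp (\<eta> $ j :: real))"
  by (intro sum_pos) auto

lemma softmax_pos: "0 < softmax \<eta> $ k"
  using softmax_denominator_pos[of \<eta>] by (simp add: softmax_def)

lemma softmax_in_simplex: "softmax \<eta> \<in> prob_simplex"
  using softmax_denominator_pos[of \<eta>]
  by (auto simp: prob_simplex_def softmax_def sum_divide_distrib[symmetric] intro!: divide_nonneg_pos)

lemma softmax_shift: "softmax (\<eta> + t *\<^sub>R 1) = softmax \<eta>"
  by (simp add: softmax_def vec_eq_iff exp_add sum_distrib_right[symmetric])

definition log_sum_exp :: "real^'k \<Rightarrow> real" where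
  "log_sum_exp \<eta> = ln (\<Sum>j\<in>UNIV. exp (\<eta> $ j))"

lemma softmax_eq_exp: "softmax \<eta> $ k = exp (\<eta> $ k - log_sum_exp \<eta>)"
  using softmax_denominator_pos[of \<eta>] by (simp add: softmax_def log_sum_exp_def exp_diff)

text \<open>The tangent bound \<open>1 + t \<le> exp t\<close>, rescaled. This lower slope is the
  origin of the exponential factor in the final constant.\<close>

lemma abs_exp_diff_ge: "exp (min a b) * \<bar>a - b\<bar> \<le> \<bar>exp a - exp b\<bar>" for a b :: real
proof -
  have *: "exp b * (a - b) \<le> exp a - exp b" if "b \<le> a" for a b :: real
  proof -
    have "exp b * (1 + (a - b)) \<le> exp b * exp (a - b)"
      by (intro mult_left_mono exp_ge_add_one_self) auto
    then show ?thesis by (simp add: exp_diff algebra_simps)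
  qed
  show ?thesis
    using *[of a b] *[of b a] by (cases "b \<le> a") (auto simp: min_def)
qed

lemma abs_exp_diff_le: "\<bar>exp a - exp b\<bar> \<le> exp (max a b) * \<bar>a - b\<bar>" for a b :: real
proof -
  have *: "exp a - exp b \<le> exp a * (a - b)" if "b \<le> a" for a b :: real
  proof -
    have "exp a * (1 + (b - a)) \<le> exp a * exp (b - a)"
      by (intro mult_left_mono exp_ge_add_one_self) auto
    then show ?thesis by (simp add: exp_diff algebra_simps)
  qed
  show ?thesis
    using *[of a b] *[of b a] by (cases "b \<le> a") (auto simp: max_def)
qed

lemma power2_norm_vec: "(norm x)\<^sup>2 = (\<Sum>k\<in>UNIV. (x $ k)\<^sup>2)" for x :: "real^'k"
  unfolding power2_norm_eq_inner inner_vec_def by (simp add: power2_eq_square)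

text \<open>Softmax is the exponential of the logits shifted by a normalizer. For centred logits the shift
  can only increase the squared distance, so it suffices to bound the slope of the exponential.\<close>

lemma softmax_distance_ge:
  fixes u v :: "real^'k"
  assumes u: "u \<bullet> 1 = 0" "infnorm u \<le> B" and v: "v \<bullet> 1 = 0" "infnorm v \<le> B"
  shows "exp (- 4 * B) / (real CARD('k))\<^sup>2 * (norm (u - v))\<^sup>2 \<le> (norm (softmax u - softmax v))\<^sup>2"
proof -
  let ?K = "real CARD('k)"
  define r where "r = log_sum_exp u - log_sum_exp v"
  have K: "0 < ?K" by simp
  have comp: "\<bar>w $ k\<bar> \<le> B" if "infnorm w \<le> B" for w :: "real^'k" and k
    using that component_le_infnorm_cart[of w k] by linarith
  \<comment> \<open>The normalizer is at most \<open>ln ?K + B\<close> and a component is at least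
    \<open>- B\<close>, so every probability is at least exp(-2B)/K; squaring this slope yields
    exp(-4B)/K^2.\<close>
  have exponent: "- 2 * B - ln ?K \<le> w $ k - log_sum_exp w" if w: "infnorm w \<le> B" for w :: "real^'k" and k
  proof -
    have "(\<Sum>j\<in>UNIV. exp (w $ j)) \<le> (\<Sum>j\<in>(UNIV::'k set). exp B)"
      using comp[OF w] by (intro sum_mono) (auto simp: abs_le_iff)
    then have "log_sum_exp w \<le> ln (?K * exp B)"
      unfolding log_sum_exp_def using softmax_denominator_pos[of w] K by simp
    also have "\<dots> = ln ?K + B" using K by (simp add: ln_mult)
    finally show ?thesis using comp[OF w, of k] by (simp add: abs_le_iff)
  qed
  have slope: "(exp (- 2 * B) / ?K)\<^sup>2 * (u $ k - v $ k - r)\<^sup>2 \<le> (softmax u $ k - softmax v $ k)\<^sup>2" for k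
  proof -
    have "exp (- 2 * B) / ?K = exp (- 2 * B - ln ?K)" using K by (simp add: exp_diff)
    also have "\<dots> \<le> exp (min (u $ k - log_sum_exp u) (v $ k - log_sum_exp v))"
      using exponent[OF u(2)] exponent[OF v(2)] by simp
    finally have "exp (- 2 * B) / ?K * \<bar>(u $ k - log_sum_exp u) - (v $ k - log_sum_exp v)\<bar>
        \<le> \<bar>softmax u $ k - softmax v $ k\<bar>"
      unfolding softmax_eq_exp
      by (intro order_trans[OF mult_right_mono abs_exp_diff_ge]) auto
    then have "(exp (- 2 * B) / ?K * \<bar>u $ k - v $ k - r\<bar>)\<^sup>2 \<le> \<bar>softmax u $ k - softmax v $ k\<bar>\<^sup>2"
      using K by (intro power_mono) (auto simp: r_def algebra_simps)
    then show ?thesis by (simp only: power_mult_distrib power2_abs)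
  qed
  have "(\<Sum>k\<in>UNIV. u $ k - v $ k) = 0"
    using u(1) v(1) by (simp add: inner_vec_def sum_subtractf)
  then have "(\<Sum>k\<in>UNIV. (u $ k - v $ k - r)\<^sup>2) = (\<Sum>k\<in>UNIV. (u $ k - v $ k)\<^sup>2) + ?K * r\<^sup>2"
    by (simp add: power2_diff sum.distrib sum_subtractf sum_distrib_left[symmetric] sum_distrib_right[symmetric])
  then have "(norm (u - v))\<^sup>2 \<le> (\<Sum>k\<in>UNIV. (u $ k - v $ k - r)\<^sup>2)"
    by (simp add: power2_norm_vec)
  then have "(exp (- 2 * B) / ?K)\<^sup>2 * (norm (u - v))\<^sup>2
      \<le> (\<Sum>k\<in>UNIV. (exp (- 2 * B) / ?K)\<^sup>2 * (u $ k - v $ k - r)\<^sup>2)"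
    unfolding sum_distrib_left[symmetric] by (intro mult_left_mono) auto
  also have "\<dots> \<le> (\<Sum>k\<in>UNIV. (softmax u $ k - softmax v $ k)\<^sup>2)"
    by (intro sum_mono slope)
  also have "\<dots> = (norm (softmax u - softmax v))\<^sup>2"
    by (simp add: power2_norm_vec)
  finally show ?thesis
    by (simp add: power_divide exp_double[symmetric] power2_eq_square exp_add[symmetric])
qed

text \<open>\<open>log_sum_exp\<close> is nonexpansive, so the exponent moves by at most twice the
  distance, and probabilities being at most 1 bounds the slope of \<open>exp\<close>. The constant
  may be crude: it feeds the integrability of the scores and never the final bound.\<close>

lemma softmax_l1_lipschitz:
  fixes u v :: "real^'k"
  shows "(\<Sum>k\<in>UNIV. \<bar>softmax u $ k - softmax v $ k\<bar>) \<le> 2 * real CARD('k) * norm (u - v)"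
proof -
  have comp: "\<bar>u $ k - v $ k\<bar> \<le> norm (u - v)" for k and u v :: "real^'k"
    using component_le_norm_cart[of "u - v" k] by simp
  have *: "log_sum_exp u \<le> log_sum_exp v + norm (u - v)" for u v :: "real^'k"
  proof -
    have "(\<Sum>j\<in>UNIV. exp (u $ j)) \<le> (\<Sum>j\<in>UNIV. exp (v $ j) * exp (norm (u - v)))"
    proof (intro sum_mono)
      fix j show "exp (u $ j) \<le> exp (v $ j) * exp (norm (u - v))"
        using comp[of u j v] by (simp add: exp_add[symmetric])
    qed
    also have "\<dots> = (\<Sum>j\<in>UNIV. exp (v $ j)) * exp (norm (u - v))"
      by (simp add: sum_distrib_right)
    finally have "log_sum_exp u \<le> ln ((\<Sum>j\<in>UNIV. exp (v $ j)) * exp (norm (u - v)))"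
      unfolding log_sum_exp_def using softmax_denominator_pos[of u] by simp
    then show ?thesis
      using softmax_denominator_pos[of v] by (simp add: log_sum_exp_def ln_mult)
  qed
  have "\<bar>softmax u $ k - softmax v $ k\<bar> \<le> 2 * norm (u - v)" for k
  proof -
    have "softmax w $ k \<le> 1" for w :: "real^'k"
      using softmax_in_simplex[of w] member_le_sum[of k UNIV "\<lambda>k. softmax w $ k"]
      by (simp add: prob_simplex_def)
    then have le1: "w $ k - log_sum_exp w \<le> 0" for w :: "real^'k"
      by (simp add: softmax_eq_exp)
    have "\<bar>softmax u $ k - softmax v $ k\<bar>
        \<le> exp (max (u $ k - log_sum_exp u) (v $ k - log_sum_exp v))
          * \<bar>(u $ k - log_sum_exp u) - (v $ k - log_sum_exp v)\<bar>"
      unfolding softmax_eq_exp by (rule abs_exp_diff_le)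
    also have "\<dots> \<le> 1 * \<bar>(u $ k - log_sum_exp u) - (v $ k - log_sum_exp v)\<bar>"
      using le1 by (intro mult_right_mono) auto
    also have "\<dots> \<le> 2 * norm (u - v)"
      using *[of u v] *[of v u] comp[of u k v] by (simp add: norm_minus_commute)
    finally show ?thesis .
  qed
  then have "(\<Sum>k\<in>UNIV. \<bar>softmax u $ k - softmax v $ k\<bar>) \<le> (\<Sum>k\<in>(UNIV::'k set). 2 * norm (u - v))"
    by (rule sum_mono)
  then show ?thesis by simp
qed

lemma has_derivative_softmax_component: "\<exists>D. ((\<lambda>\<eta>. softmax \<eta> $ k) has_derivative D) (at \<eta>)"
proof -
  have "((\<lambda>\<eta>. exp (\<eta> $ k) / (\<Sum>j\<in>UNIV. exp (\<eta> $ j))) has_derivative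
     (\<lambda>h. - exp (\<eta> $ k) * (inverse (\<Sum>j\<in>UNIV. exp (\<eta> $ j)) * (\<Sum>j\<in>UNIV. h $ j * exp (\<eta> $ j)) * inverse (\<Sum>j\<in>UNIV. exp (\<eta> $ j)))
       + h $ k * exp (\<eta> $ k) / (\<Sum>j\<in>UNIV. exp (\<eta> $ j)))) (at \<eta>)"
    using softmax_denominator_pos[of \<eta>]
    by (auto intro!: derivative_eq_intros bounded_linear.has_derivative[OF bounded_linear_vec_nth]
          simp: fun_eq_iff field_simps)
  then show ?thesis unfolding softmax_def by auto
qed

lemma continuous_on_softmax: "continuous_on S softmax"
  unfolding softmax_def
  by (intro continuous_intros ballI) (use softmax_denominator_pos in \<open>force simp: less_le\<close>)+

lemma norm_linear_combination_le:
  fixes g :: "'k::finite \<Rightarrow> 'a::real_normed_vector"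
  assumes "\<And>k. norm (g k) \<le> G"
  shows "norm (\<Sum>k\<in>UNIV. t k *\<^sub>R g k) \<le> G * (\<Sum>k\<in>UNIV. \<bar>t k\<bar>)"
proof -
  have "norm (\<Sum>k\<in>UNIV. t k *\<^sub>R g k) \<le> (\<Sum>k\<in>UNIV. norm (t k *\<^sub>R g k))" by (rule norm_sum)
  also have "\<dots> \<le> (\<Sum>k\<in>UNIV. \<bar>t k\<bar> * G)"
    using assms by (intro sum_mono) (auto intro: mult_left_mono)
  finally show ?thesis by (simp add: sum_distrib_left mult.commute)
qed

section \<open>Costs of softmax logits\<close>

text \<open>Each coordinate is a pointwise limit of difference quotients of a continuous function,
  hence measurable even if the gradient is discontinuous.\<close>

lemma borel_measurable_gradient:
  fixes f :: "'a::euclidean_space \<Rightarrow> real"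
  assumes g: "\<And>x. GDERIV f x :> g x"
  shows "g \<in> borel_measurable borel"
proof (subst borel_measurable_euclidean_space, rule ballI)
  fix i :: 'a assume "i \<in> Basis"
  have "continuous_on UNIV f"
    using g unfolding gderiv_def
    by (meson continuous_at_imp_continuous_on has_derivative_continuous)
  then have f: "f \<in> borel_measurable borel" by (rule borel_measurable_continuous_onI)
  show "(\<lambda>x. g x \<bullet> i) \<in> borel_measurable borel"
  proof (rule borel_measurable_LIMSEQ_real)
    fix x
    have "((\<lambda>t. f (x + t *\<^sub>R i)) has_real_derivative (i \<bullet> g x)) (at 0)"
      by (rule GDERIV_along_line) (simp add: g)
    then have "(\<lambda>t. (f (x + t *\<^sub>R i) - f x) / t) \<midarrow>0\<rightarrow> g x \<bullet> i"
      by (simp add: DERIV_def inner_commute)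
    moreover have "filterlim (\<lambda>n. 1 / real (Suc n)) (at 0) sequentially"
      unfolding filterlim_at using LIMSEQ_inverse_real_of_nat
      by (auto simp: inverse_eq_divide simp del: of_nat_Suc)
    ultimately show "(\<lambda>n. (f (x + (1 / real (Suc n)) *\<^sub>R i) - f x) / (1 / real (Suc n))) \<longlonglongrightarrow> g x \<bullet> i"
      by (rule filterlim_compose)
  next
    fix n
    show "(\<lambda>x. (f (x + (1 / real (Suc n)) *\<^sub>R i) - f x) / (1 / real (Suc n))) \<in> borel_measurable borel"
      using f by measurable
  qed
qed

locale convex_cost =
  fixes c :: "real^'d \<Rightarrow> 'k::finite \<Rightarrow> real" and \<mu> G :: real
  assumes modulus_pos: "0 < \<mu>"
    and hessian: "\<And>a k. \<exists>H. has_hessian (\<lambda>a. c a k) H a \<and> loewner_le (\<lambda>v. \<mu> *\<^sub>R v) H"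
    and gradient_bound: "\<And>a k. a \<in> convex hull (opt_action c ` prob_simplex) \<Longrightarrow>
      norm (grad (\<lambda>a. c a k) a) \<le> G"
begin

abbreviation cost_grad :: "'k \<Rightarrow> real^'d \<Rightarrow> real^'d" where
  "cost_grad k \<equiv> grad (\<lambda>a. c a k)"

abbreviation mixed_grad :: "real^'k \<Rightarrow> real^'d \<Rightarrow> real^'d" where
  "mixed_grad p a \<equiv> \<Sum>k\<in>UNIV. p $ k *\<^sub>R cost_grad k a"

section \<open>Expected costs and regularity of the optimal action\<close>

lemma opt_in_hull: "p \<in> prob_simplex \<Longrightarrow> opt_action c p \<in> convex hull (opt_action c ` prob_simplex)"
  by (intro hull_inc) auto

lemma G_nonneg: "0 \<le> G"
  using gradient_bound[OF opt_in_hull[OF softmax_in_simplex]] norm_ge_zero order_trans by blast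

lemma GDERIV_cost: "GDERIV (\<lambda>a. c a k) a :> cost_grad k a"
  using hessian[of k a] eventually_nhds_x_imp_x unfolding has_hessian_def by blast

lemma GDERIV_mixed: "GDERIV (\<lambda>a. \<Sum>k\<in>UNIV. p $ k * c a k) a :> mixed_grad p a"
  by (intro GDERIV_sum GDERIV_cmult GDERIV_cost)

lemma cost_grad_monotone: "\<mu> * (norm (x - y))\<^sup>2 \<le> (cost_grad k x - cost_grad k y) \<bullet> (x - y)"
  using hessian unfolding has_hessian_def by (intro hessian_strongly_monotone) blast

lemma mixed_grad_monotone:
  assumes "p \<in> prob_simplex"
  shows "\<mu> * (norm (x - y))\<^sup>2 \<le> (mixed_grad p x - mixed_grad p y) \<bullet> (x - y)"
proof -
  have "\<mu> * (norm (x - y))\<^sup>2 = (\<Sum>k\<in>UNIV. p $ k * (\<mu> * (norm (x - y))\<^sup>2))"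
    using assms by (simp add: prob_simplex_def sum_distrib_right[symmetric])
  also have "\<dots> \<le> (\<Sum>k\<in>UNIV. p $ k * ((cost_grad k x - cost_grad k y) \<bullet> (x - y)))"
    using assms cost_grad_monotone by (intro sum_mono mult_left_mono) (auto simp: prob_simplex_def)
  also have "\<dots> = (mixed_grad p x - mixed_grad p y) \<bullet> (x - y)"
    by (simp add: sum_subtractf[symmetric] scaleR_diff_right[symmetric] inner_sum_left)
  finally show ?thesis .
qed

lemma mixed_grad_distance:
  assumes "p \<in> prob_simplex"
  shows "\<mu> * norm (x - y) \<le> norm (mixed_grad p x - mixed_grad p y)"
proof (cases "x = y")
  case False
  have "norm (x - y) * (\<mu> * norm (x - y)) \<le> norm (x - y) * norm (mixed_grad p x - mixed_grad p y)"
    using mixed_grad_monotone[OF assms, of x y] norm_cauchy_schwarz[of "mixed_grad p x - mixed_grad p y" "x - y"]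
    by (simp add: power2_eq_square ac_simps)
  with False show ?thesis by simp
qed simp

text \<open>Subtracting a linear functional keeps the expected cost strongly convex, and the
  minimizer of the tilted cost has gradient \<open>u\<close>. This supplies the inverse map used to
  differentiate the optimal action.\<close>

lemma mixed_grad_surj:
  assumes "p \<in> prob_simplex"
  shows "\<exists>a. mixed_grad p a = u"
proof -
  have g: "GDERIV (\<lambda>a. (\<Sum>k\<in>UNIV. p $ k * c a k) - a \<bullet> u) x :> mixed_grad p x - u" for x
  proof (intro GDERIV_diff GDERIV_mixed)
    show "GDERIV (\<lambda>a. a \<bullet> u) x :> u"
      unfolding gderiv_def by (rule bounded_linear.has_derivative[OF bounded_linear_inner_left]) auto
  qed
  have "\<mu> * (norm (x - y))\<^sup>2 \<le> ((mixed_grad p x - u) - (mixed_grad p y - u)) \<bullet> (x - y)" for x y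
    using mixed_grad_monotone[OF assms] by simp
  from strongly_convex_minimizer[OF g this modulus_pos] obtain m where
    "\<And>y. (\<Sum>k\<in>UNIV. p $ k * c m k) - m \<bullet> u \<le> (\<Sum>k\<in>UNIV. p $ k * c y k) - y \<bullet> u" by blast
  from GDERIV_minimum[OF g this] show ?thesis by auto
qed

text \<open>\<open>opt_action\<close> is defined by choice, so its minimality rests on the existence
  of a minimizer, which strong convexity provides.\<close>

lemma opt_action_minimal:
  assumes "p \<in> prob_simplex"
  shows "(\<Sum>k\<in>UNIV. p $ k * c (opt_action c p) k) \<le> (\<Sum>k\<in>UNIV. p $ k * c a k)"
proof -
  obtain m where "\<And>y. (\<Sum>k\<in>UNIV. p $ k * c m k) \<le> (\<Sum>k\<in>UNIV. p $ k * c y k)"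
    using strongly_convex_minimizer[OF GDERIV_mixed mixed_grad_monotone[OF assms] modulus_pos] by blast
  then have "is_arg_min (\<lambda>w. \<Sum>k\<in>UNIV. p $ k * c w k) (\<lambda>_. True) m"
    by (simp add: is_arg_min_linorder)
  then have "is_arg_min (\<lambda>w. \<Sum>k\<in>UNIV. p $ k * c w k) (\<lambda>_. True) (opt_action c p)"
    unfolding opt_action_def arg_min_def by (rule someI)
  then show ?thesis by (simp add: is_arg_min_linorder)
qed

lemma opt_action_stationary:
  assumes "p \<in> prob_simplex"
  shows "mixed_grad p (opt_action c p) = 0"
  by (rule GDERIV_minimum[OF GDERIV_mixed opt_action_minimal[OF assms]])

text \<open>Quadratic growth at a stationary point; the factor \<mu>/2, and with it
  \<open>C\<^sub>0\<close>, comes from here.\<close>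

lemma opt_action_gap:
  assumes "p \<in> prob_simplex"
  shows "\<mu> / 2 * (norm (a - opt_action c p))\<^sup>2
    \<le> (\<Sum>k\<in>UNIV. p $ k * (c a k - c (opt_action c p) k))"
  using strongly_convex_lower_bound[OF GDERIV_mixed mixed_grad_monotone[OF assms], of "opt_action c p" a]
  by (simp add: opt_action_stationary[OF assms] right_diff_distrib sum_subtractf)

text \<open>At the optimal action for \<open>q\<close>, the mixed gradient for \<open>p\<close> is a
  combination of cost gradients with weights \<open>p - q\<close>. Strong monotonicity turns its
  norm into a distance to the zero of that gradient.\<close>

lemma opt_action_lipschitz:
  assumes p: "p \<in> prob_simplex" and q: "q \<in> prob_simplex"
  shows "norm (opt_action c p - opt_action c q) \<le> G / \<mu> * (\<Sum>k\<in>UNIV. \<bar>p $ k - q $ k\<bar>)"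
proof -
  let ?y = "opt_action c q"
  have "\<mu> * norm (opt_action c p - ?y) \<le> norm (0 - mixed_grad p ?y)"
    using mixed_grad_distance[OF p, of "opt_action c p" ?y] opt_action_stationary[OF p] by simp
  also have "0 - mixed_grad p ?y = (\<Sum>k\<in>UNIV. (q $ k - p $ k) *\<^sub>R cost_grad k ?y)"
    using opt_action_stationary[OF q] by (simp add: scaleR_diff_left sum_subtractf)
  also have "norm \<dots> \<le> G * (\<Sum>k\<in>UNIV. \<bar>q $ k - p $ k\<bar>)"
    by (intro norm_linear_combination_le gradient_bound opt_in_hull q)
  finally show ?thesis
    using modulus_pos by (simp add: field_simps abs_minus_commute)
qed

text \<open>The intermediate point of the mean value theorem lies between two optimal actions, hence
  in the convex hull, the region on which \<open>G\<close> is known to bound the gradients.\<close>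

lemma cost_lipschitz:
  assumes p: "p \<in> prob_simplex" and q: "q \<in> prob_simplex"
  shows "\<bar>c (opt_action c p) k - c (opt_action c q) k\<bar> \<le> G * norm (opt_action c p - opt_action c q)"
proof -
  define x v where "x = opt_action c q" and "v = opt_action c p - opt_action c q"
  have der: "((\<lambda>t. c (x + t *\<^sub>R v) k) has_real_derivative v \<bullet> cost_grad k (x + t *\<^sub>R v)) (at t)" for t
    by (rule GDERIV_along_line[OF GDERIV_cost])
  obtain t where t: "0 < t" "t < 1"
    and eq: "c (x + 1 *\<^sub>R v) k - c (x + 0 *\<^sub>R v) k = (1 - 0) * (v \<bullet> cost_grad k (x + t *\<^sub>R v))"
    using MVT2[OF zero_less_one der] by blast
  have "x + t *\<^sub>R v = (1 - t) *\<^sub>R opt_action c q + t *\<^sub>R opt_action c p"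
    unfolding x_def v_def by (simp add: algebra_simps)
  also have "\<dots> \<in> convex hull (opt_action c ` prob_simplex)"
    using t by (intro convexD_alt[OF convex_convex_hull] opt_in_hull p q) auto
  finally have "norm (cost_grad k (x + t *\<^sub>R v)) \<le> G" by (rule gradient_bound)
  then have "norm v * norm (cost_grad k (x + t *\<^sub>R v)) \<le> norm v * G" by (intro mult_left_mono) auto
  then have "\<bar>v \<bullet> cost_grad k (x + t *\<^sub>R v)\<bar> \<le> G * norm v"
    using Cauchy_Schwarz_ineq2[of v "cost_grad k (x + t *\<^sub>R v)"] by (simp add: mult.commute)
  then show ?thesis using eq by (simp add: x_def v_def)
qed

text \<open>The pair of logits and mixed gradient determines the pair of logits and action, so the
  derivative of the optimal action comes from inverting that correspondence.\<close>

lemma opt_action_softmax_differentiable: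
  "\<exists>D. ((\<lambda>\<eta>. opt_action c (softmax \<eta>)) has_derivative D) (at \<eta>)"
proof -
  define w where "w = opt_action c (softmax \<eta>)"
  have stat: "mixed_grad (softmax \<eta>) w = 0"
    unfolding w_def by (rule opt_action_stationary[OF softmax_in_simplex])
  obtain H where H: "\<And>k. (cost_grad k has_derivative H k) (at w)" "\<And>k. loewner_le (\<lambda>v. \<mu> *\<^sub>R v) (H k)"
    using hessian[where a = w] unfolding has_hessian_def by metis
  obtain S where S: "\<And>k. ((\<lambda>\<eta>. softmax \<eta> $ k) has_derivative S k) (at \<eta>)"
    using has_derivative_softmax_component by metis
  \<comment> \<open>The Hessian of the expected cost in the action; bounded below by \<mu>, it is
    injective and so has a linear left inverse.\<close>
  define A where "A v = (\<Sum>k\<in>UNIV. softmax \<eta> $ k *\<^sub>R H k v)" for v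
  have Hlin: "linear (H k)" for k using H(1) has_derivative_linear by blast
  have Slin: "bounded_linear (S k)" for k using S has_derivative_bounded_linear by blast
  have A: "linear A"
    unfolding A_def by (intro linear_compose_sum ballI linear_compose_scale_right) (use Hlin in auto)
  have "v = 0" if "A v = 0" for v
  proof -
    have "\<mu> * (v \<bullet> v) = (\<Sum>k\<in>UNIV. softmax \<eta> $ k * (\<mu> * (v \<bullet> v)))"
      using softmax_in_simplex[of \<eta>] by (simp add: prob_simplex_def sum_distrib_right[symmetric])
    also have "\<dots> \<le> (\<Sum>k\<in>UNIV. softmax \<eta> $ k * (v \<bullet> H k v))"
      using H(2) softmax_in_simplex[of \<eta>]
      by (intro sum_mono mult_left_mono) (auto simp: prob_simplex_def loewner_le_def)
    also have "\<dots> = v \<bullet> A v" by (simp add: A_def inner_sum_right)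
    finally have "\<mu> * (v \<bullet> v) \<le> 0" using that by simp
    then show ?thesis
      using modulus_pos inner_gt_zero_iff[of v] by (auto simp: mult_le_0_iff simp del: inner_gt_zero_iff)
  qed
  then have "inj A" using A by (auto simp: linear_injective_0)
  then obtain A' where A': "linear A'" "A' \<circ> A = id"
    using linear_injective_left_inverse[OF A] by blast
  then have A'A: "A' (A v) = v" for v by (metis comp_apply id_apply)
  \<comment> \<open>Carrying the logits as first coordinate makes the implicit equation an
    inversion. Without continuous Hessians the C^1 inverse function theorem is out of reach, but a
    right inverse defined everywhere and continuous at one point suffices.\<close>
  define \<Phi> where "\<Phi> z = (fst z, mixed_grad (softmax (fst z)) (snd z))" for z :: "(real^'k) \<times> (real^'d)"
  define \<Psi> where "\<Psi> z = (fst z, SOME a. mixed_grad (softmax (fst z)) a = snd z)" for z :: "(real^'k) \<times> (real^'d)"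
  have \<Psi>: "mixed_grad (softmax (fst z)) (snd (\<Psi> z)) = snd z" for z
    unfolding \<Psi>_def using someI_ex[OF mixed_grad_surj[OF softmax_in_simplex]] by simp
  have unique: "snd (\<Psi> (\<eta>, 0)) = opt_action c (softmax \<eta>)" for \<eta>
  proof -
    have "\<mu> * norm (snd (\<Psi> (\<eta>, 0)) - opt_action c (softmax \<eta>)) \<le> 0"
      using mixed_grad_distance[OF softmax_in_simplex, of "snd (\<Psi> (\<eta>, 0))" "opt_action c (softmax \<eta>)" \<eta>]
        \<Psi>[of "(\<eta>, 0)"] opt_action_stationary[OF softmax_in_simplex, of \<eta>] by simp
    then show ?thesis using modulus_pos by (simp add: mult_le_0_iff)
  qed
  then have \<Psi>0: "\<Psi> (\<eta>, 0) = (\<eta>, w)" unfolding w_def \<Psi>_def by simp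
  let ?C = "\<lambda>h. \<Sum>k\<in>UNIV. S k h *\<^sub>R cost_grad k w"
  \<comment> \<open>Solves the linearized equation \<open>A v + ?C h = u\<close> for
    \<open>v\<close>.\<close>
  define \<Psi>' where "\<Psi>' z = (fst z, A' (snd z - ?C (fst z)))" for z
  have "(\<Psi> has_derivative \<Psi>') (at (\<eta>, 0))"
  proof (rule has_derivative_inverse_basic[where T = UNIV and f = \<Phi>
        and f' = "\<lambda>z. (fst z, \<Sum>k\<in>UNIV. softmax \<eta> $ k *\<^sub>R H k (snd z) + S k (fst z) *\<^sub>R cost_grad k w)"])
    have "((\<lambda>z. softmax (fst z) $ k) has_derivative (\<lambda>z. S k (fst z))) (at (\<eta>, w))" for k
      by (rule has_derivative_compose[of fst fst "(\<eta>, w)"]) (auto intro!: derivative_intros S)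
    moreover have "((\<lambda>z. cost_grad k (snd z)) has_derivative (\<lambda>z. H k (snd z))) (at (\<eta>, w))" for k
      by (rule has_derivative_compose[of snd snd "(\<eta>, w)"]) (auto intro!: derivative_intros H)
    ultimately have "((\<lambda>z. mixed_grad (softmax (fst z)) (snd z)) has_derivative
        (\<lambda>z. \<Sum>k\<in>UNIV. softmax (fst (\<eta>, w)) $ k *\<^sub>R H k (snd z) + S k (fst z) *\<^sub>R cost_grad k (snd (\<eta>, w)))) (at (\<eta>, w))"
      by (intro has_derivative_sum has_derivative_scaleR)
    then show "(\<Phi> has_derivative (\<lambda>z. (fst z, \<Sum>k\<in>UNIV. softmax \<eta> $ k *\<^sub>R H k (snd z) + S k (fst z) *\<^sub>R cost_grad k w)))
        (at (\<Psi> (\<eta>, 0)))"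
      unfolding \<Phi>_def \<Psi>0 by (intro has_derivative_Pair) (auto intro!: derivative_intros)
    have "bounded_linear ?C"
      by (intro bounded_linear_sum bounded_linear_compose[OF bounded_linear_scaleR_left] Slin)
    moreover have "bounded_linear A'" using A'(1) by (simp add: linear_conv_bounded_linear)
    ultimately show "bounded_linear \<Psi>'"
      unfolding \<Psi>'_def
      by (rule bounded_linear_Pair[OF bounded_linear_fst bounded_linear_compose[of A',
          OF _ bounded_linear_sub[OF bounded_linear_snd bounded_linear_compose[OF _ bounded_linear_fst]]], rotated])
    show "\<Psi>' \<circ> (\<lambda>z. (fst z, \<Sum>k\<in>UNIV. softmax \<eta> $ k *\<^sub>R H k (snd z) + S k (fst z) *\<^sub>R cost_grad k w)) = id"
      unfolding \<Psi>'_def by (auto simp: fun_eq_iff sum.distrib A_def[symmetric] A'A)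
    show "continuous (at (\<eta>, 0)) \<Psi>"
    proof -
      have lim: "((\<lambda>z. norm (snd z - mixed_grad (softmax (fst z)) w) / \<mu>) \<longlongrightarrow> norm (0 - mixed_grad (softmax \<eta>) w) / \<mu>) (at (\<eta>, 0))"
      proof -
        have "continuous_on UNIV (\<lambda>z::(real^'k) \<times> (real^'d). norm (snd z - mixed_grad (softmax (fst z)) w) / \<mu>)"
        proof -
          have "continuous_on UNIV (\<lambda>z::(real^'k) \<times> (real^'d). softmax (fst z))"
            by (rule continuous_on_compose2[OF continuous_on_softmax[of UNIV] continuous_on_fst[OF continuous_on_id]]) simp
          then show ?thesis
            using modulus_pos by (intro continuous_intros) auto
        qed
        then have "isCont (\<lambda>z::(real^'k) \<times> (real^'d). norm (snd z - mixed_grad (softmax (fst z)) w) / \<mu>) (\<eta>, 0)"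
          by (simp add: continuous_on_eq_continuous_at)
        then show ?thesis unfolding isCont_def by simp
      qed
      \<comment> \<open>Strong monotonicity bounds the change of action by the gradient mismatch at
        the fixed \<open>w\<close>, which is continuous in \<open>z\<close> and vanishes at
        \<open>(\<eta>, 0)\<close>.\<close>
      have bound: "norm (snd (\<Psi> z) - w) \<le> norm (snd z - mixed_grad (softmax (fst z)) w) / \<mu>" for z
        using mixed_grad_distance[OF softmax_in_simplex, of "snd (\<Psi> z)" w "fst z"] modulus_pos
        by (simp add: \<Psi> field_simps)
      have "((\<lambda>z. snd (\<Psi> z) - w) \<longlongrightarrow> 0) (at (\<eta>, 0))"
        by (rule Lim_null_comparison[OF always_eventually[OF allI[OF bound]]]) (use lim stat in simp)
      then have "((\<lambda>z. snd (\<Psi> z)) \<longlongrightarrow> w) (at (\<eta>, 0))" by (simp add: LIM_zero_iff)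
      then have "((\<lambda>z. (fst z, snd (\<Psi> z))) \<longlongrightarrow> (fst (\<eta>, 0::real^'d), w)) (at (\<eta>, 0))"
        by (intro tendsto_Pair tendsto_fst tendsto_ident_at)
      moreover have "(\<lambda>z. (fst z, snd (\<Psi> z))) = \<Psi>" by (simp add: \<Psi>_def fun_eq_iff)
      ultimately show ?thesis unfolding isCont_def \<Psi>0 by simp
    qed
    show "\<Phi> (\<Psi> z) = z" for z
      using \<Psi>[of z] unfolding \<Phi>_def by (simp add: \<Psi>_def)
  qed auto
  moreover have "((\<lambda>\<eta>. (\<eta>, 0::real^'d)) has_derivative (\<lambda>h. (h, 0))) (at \<eta>)"
    by (auto intro!: derivative_intros)
  ultimately have "((\<lambda>\<eta>. snd (\<Psi> (\<eta>, 0))) has_derivative (\<lambda>h. snd (\<Psi>' (h, 0)))) (at \<eta>)"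
    by (intro has_derivative_snd) (rule has_derivative_compose[of "\<lambda>\<eta>. (\<eta>, 0)"])
  then show ?thesis unfolding unique by blast
qed

section \<open>Costs as functions of the logits\<close>

definition logit_cost :: "'k \<Rightarrow> real^'k \<Rightarrow> real" where
  "logit_cost k \<eta> = c (opt_action c (softmax \<eta>)) k"

text \<open>Product of the Lipschitz constants of the cost in the action, of the action in the
  distribution (in the l1 norm), and of softmax in the logits.\<close>

definition logit_lipschitz :: real where
  "logit_lipschitz = G * (G / \<mu> * (2 * real CARD('k)))"

lemma logit_lipschitz_nonneg: "0 \<le> logit_lipschitz"
  using G_nonneg modulus_pos by (simp add: logit_lipschitz_def)

lemma logit_cost_shift: "logit_cost k (\<eta> + t *\<^sub>R 1) = logit_cost k \<eta>"
  by (simp add: logit_cost_def softmax_shift)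

lemma GDERIV_logit_cost: "GDERIV (logit_cost k) \<eta> :> grad (logit_cost k) \<eta>"
proof -
  obtain D where D: "((\<lambda>\<eta>. opt_action c (softmax \<eta>)) has_derivative D) (at \<eta>)"
    using opt_action_softmax_differentiable by blast
  define g where "g = cost_grad k (opt_action c (softmax \<eta>))"
  have "(logit_cost k has_derivative (\<lambda>h. D h \<bullet> g)) (at \<eta>)"
    unfolding logit_cost_def g_def
    by (rule has_derivative_compose[OF D GDERIV_cost[unfolded gderiv_def]])
  moreover have "D h \<bullet> g = h \<bullet> adjoint D g" for h
    using adjoint_works[OF has_derivative_linear[OF D], of h g] by (simp add: inner_commute)
  ultimately have "GDERIV (logit_cost k) \<eta> :> adjoint D g" by (simp add: gderiv_def)
  then show ?thesis by (simp add: grad_eq)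
qed

lemma logit_cost_lipschitz:
  "\<bar>logit_cost k u - logit_cost k v\<bar> \<le> logit_lipschitz * norm (u - v)"
proof -
  have "\<bar>logit_cost k u - logit_cost k v\<bar>
      \<le> G * (G / \<mu> * (\<Sum>k\<in>UNIV. \<bar>softmax u $ k - softmax v $ k\<bar>))"
    unfolding logit_cost_def using G_nonneg
    by (intro order_trans[OF cost_lipschitz] mult_left_mono opt_action_lipschitz softmax_in_simplex)
  also have "\<dots> \<le> G * (G / \<mu> * (2 * real CARD('k) * norm (u - v)))"
    using G_nonneg modulus_pos by (intro mult_left_mono softmax_l1_lipschitz) auto
  finally show ?thesis by (simp add: logit_lipschitz_def)
qed

text \<open>Two distributions are at l1 distance at most 2, so the Lipschitz bounds confine the cost
  uniformly in the logits, which makes every risk a finite integral.\<close>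

lemma logit_cost_bounded:
  "\<bar>logit_cost k u\<bar> \<le> \<bar>logit_cost k 0\<bar> + 2 * G\<^sup>2 / \<mu>"
proof -
  have "(\<Sum>k\<in>UNIV. \<bar>softmax u $ k - softmax 0 $ k\<bar>) \<le> (\<Sum>k\<in>UNIV. softmax u $ k + softmax (0 :: real^'k) $ k)"
  proof (rule sum_mono)
    fix k
    show "\<bar>softmax u $ k - softmax 0 $ k\<bar> \<le> softmax u $ k + softmax (0 :: real^'k) $ k"
      using softmax_pos[of u k] softmax_pos[of "0 :: real^'k" k] by linarith
  qed
  also have "\<dots> = 2"
    using softmax_in_simplex[of u] softmax_in_simplex[of "0 :: real^'k"]
    by (simp add: sum.distrib prob_simplex_def)
  finally have "G * (G / \<mu> * (\<Sum>k\<in>UNIV. \<bar>softmax u $ k - softmax 0 $ k\<bar>)) \<le> G * (G / \<mu> * 2)"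
    using G_nonneg modulus_pos by (intro mult_left_mono) auto
  then have "\<bar>logit_cost k u - logit_cost k 0\<bar> \<le> G * (G / \<mu> * 2)"
    unfolding logit_cost_def using G_nonneg
    by (elim order_trans[rotated]) (intro order_trans[OF cost_lipschitz] mult_left_mono opt_action_lipschitz softmax_in_simplex)
  moreover have "G * (G / \<mu> * 2) = 2 * G\<^sup>2 / \<mu>" by (simp add: power2_eq_square)
  ultimately show ?thesis by linarith
qed

lemma logit_cost_grad_bound: "norm (grad (logit_cost k) \<eta>) \<le> logit_lipschitz"
  by (rule GDERIV_lipschitz_bound[OF GDERIV_logit_cost logit_lipschitz_nonneg logit_cost_lipschitz])

lemma logit_cost_grad_measurable [measurable]: "grad (logit_cost k) \<in> borel_measurable borel"
  by (rule borel_measurable_gradient) (rule GDERIV_logit_cost)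

lemma logit_cost_measurable [measurable]: "logit_cost k \<in> borel_measurable borel"
proof (rule borel_measurable_continuous_onI)
  show "continuous_on UNIV (logit_cost k)"
    using GDERIV_logit_cost unfolding gderiv_def
    by (meson continuous_at_imp_continuous_on has_derivative_continuous)
qed

end

section \<open>Positive eigenvalues\<close>

text \<open>Eigenvectors chosen for distinct eigenvalues are orthogonal, hence independent, hence
  finitely many. Finiteness is what gives \<open>Min\<close> in \<open>min_pos_eigenvalue\<close>
  its meaning.\<close>

lemma finite_positive_eigenvalues:
  fixes A :: "real^'n^'n"
  assumes sym: "\<And>u v. u \<bullet> (A *v v) = v \<bullet> (A *v u)"
  shows "finite {l. 0 < l \<and> (\<exists>v. v \<noteq> 0 \<and> A *v v = l *\<^sub>R v)}" (is "finite ?S")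
proof -
  define f where "f l = (SOME v. v \<noteq> 0 \<and> A *v v = l *\<^sub>R v)" for l
  have "f l \<noteq> 0 \<and> A *v f l = l *\<^sub>R f l" if "l \<in> ?S" for l
    using someI_ex[of "\<lambda>v. v \<noteq> 0 \<and> A *v v = l *\<^sub>R v"] that unfolding f_def by blast
  then have f: "f l \<noteq> 0" "A *v f l = l *\<^sub>R f l" if "l \<in> ?S" for l using that by blast+
  have inj: "inj_on f ?S"
  proof (rule inj_onI)
    fix l m assume lm: "l \<in> ?S" "m \<in> ?S" and eq: "f l = f m"
    have "l *\<^sub>R f l = m *\<^sub>R f l"
      unfolding f(2)[OF lm(1), symmetric] unfolding eq by (rule f(2)[OF lm(2)])
    with f(1)[OF lm(1)] show "l = m" unfolding scaleR_cancel_right by blast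
  qed
  have "orthogonal (f l) (f m)" if "l \<in> ?S" "m \<in> ?S" "l \<noteq> m" for l m
  proof -
    have "m * (f l \<bullet> f m) = l * (f l \<bullet> f m)"
      using sym[of "f l" "f m"] f(2)[OF that(1)] f(2)[OF that(2)] by (simp add: inner_commute)
    with that show ?thesis by (simp add: orthogonal_def)
  qed
  then have "pairwise orthogonal (f ` ?S)"
    unfolding pairwise_def by (metis (no_types, lifting) imageE)
  moreover have "0 \<notin> f ` ?S" using f(1) by force
  ultimately have "independent (f ` ?S)" by (rule pairwise_orthogonal_independent)
  then have "finite (f ` ?S)" by (rule independent_imp_finite)
  then show ?thesis using inj by (rule finite_imageD)
qed

text \<open>The minimum of the quadratic form over unit vectors orthogonal to the kernel is attained, and
  a minimizer is an eigenvector.\<close>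

lemma min_pos_eigenvalue_le:
  fixes A :: "real^'n^'n"
  assumes sym: "\<And>u v. u \<bullet> (A *v v) = v \<bullet> (A *v u)" and psd: "\<And>v. 0 \<le> v \<bullet> (A *v v)"
    and nontrivial: "\<exists>u. u \<noteq> 0 \<and> (\<forall>v. A *v v = 0 \<longrightarrow> u \<bullet> v = 0)"
  shows "0 < min_pos_eigenvalue A"
    and "\<And>u. (\<And>v. A *v v = 0 \<Longrightarrow> u \<bullet> v = 0) \<Longrightarrow> min_pos_eigenvalue A * (norm u)\<^sup>2 \<le> u \<bullet> (A *v u)"
proof -
  define W where "W = {u. \<forall>v. A *v v = 0 \<longrightarrow> u \<bullet> v = 0}"
  have W: "subspace W"
    unfolding W_def subspace_def by (auto simp: inner_add_left)
  have "(A *v u) \<bullet> v = 0" if "A *v v = 0" for u v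
    using sym[of v u] that by (simp add: inner_commute)
  then have AW: "A *v u \<in> W" for u by (simp add: W_def)
  have cont: "continuous_on S (\<lambda>u. u \<bullet> (A *v u))" for S
    by (intro continuous_intros linear_continuous_on matrix_vector_mul_bounded_linear)
  have "sphere 0 1 \<inter> W \<noteq> {}"
  proof -
    obtain u where u: "u \<noteq> 0" "u \<in> W" using nontrivial unfolding W_def by blast
    then have "(1 / norm u) *\<^sub>R u \<in> sphere 0 1 \<inter> W" using W by (simp add: subspace_scale)
    then show ?thesis by blast
  qed
  moreover have "compact (sphere 0 1 \<inter> W)"
    by (intro compact_Int_closed closed_subspace W compact_sphere)
  ultimately obtain u where u: "norm u = 1" "u \<in> W"
    and min: "\<And>v. norm v = 1 \<Longrightarrow> v \<in> W \<Longrightarrow> u \<bullet> (A *v u) \<le> v \<bullet> (A *v v)"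
    using continuous_attains_inf[OF _ _ cont] by force
  define l where "l = u \<bullet> (A *v u)"
  define q where "q v = v \<bullet> (A *v v) - l * (v \<bullet> v)" for v
  have q_nonneg: "0 \<le> q v" if "v \<in> W" for v
  proof (cases "v = 0")
    case False
    have "l \<le> ((1 / norm v) *\<^sub>R v) \<bullet> (A *v ((1 / norm v) *\<^sub>R v))"
      unfolding l_def using False that W by (intro min) (auto simp: subspace_scale)
    also have "\<dots> = (v \<bullet> (A *v v)) / (norm v)\<^sup>2"
      by (simp add: matrix_vector_mult_scaleR power2_eq_square)
    finally show ?thesis using False by (simp add: q_def power2_norm_eq_inner field_simps)
  qed (simp add: q_def)
  \<comment> \<open>Half the gradient of \<open>q\<close> at its zero \<open>u\<close>. As
    \<open>A\<close> maps into \<open>W\<close>, the direction \<open>d\<close> is admissible, so a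
    nonzero \<open>d\<close> would allow \<open>q\<close> to become negative on
    \<open>W\<close>.\<close>
  define d where "d = A *v u - l *\<^sub>R u"
  have "d \<in> W" unfolding d_def using W AW u by (simp add: subspace_diff subspace_scale)
  have expand: "q (u + t *\<^sub>R d) = 2 * t * (d \<bullet> d) + t\<^sup>2 * q d" for t
  proof -
    have "u \<bullet> (A *v d) = d \<bullet> (A *v u)" by (rule sym)
    moreover have "d \<bullet> (A *v u) = d \<bullet> d + l * (d \<bullet> u)"
      by (simp add: d_def inner_diff_right inner_diff_left algebra_simps)
    moreover have "u \<bullet> (A *v u) = l * (u \<bullet> u)" using u by (simp add: l_def norm_eq_1)
    ultimately show ?thesis
      unfolding q_def
      by (simp add: matrix_vector_right_distrib matrix_vector_mult_scaleR inner_add_left inner_add_right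
          inner_commute[of u d] power2_eq_square algebra_simps)
  qed
  have "d \<bullet> d = 0"
  proof (rule ccontr)
    assume "d \<bullet> d \<noteq> 0"
    then have pos: "0 < d \<bullet> d" using inner_ge_zero[of d] by linarith
    \<comment> \<open>The minimizing step for curvature \<open>q d + 1\<close>; adding 1 avoids
      division by zero and still leaves the negative value
      \<open>t * (d \<bullet> d)\<close>.\<close>
    define t where "t = - (d \<bullet> d) / (q d + 1)"
    have qd: "0 \<le> q d" using q_nonneg \<open>d \<in> W\<close> by blast
    have "0 \<le> 2 * t * (d \<bullet> d) + t\<^sup>2 * q d"
      unfolding expand[symmetric] using W u \<open>d \<in> W\<close> by (intro q_nonneg) (simp add: subspace_add subspace_scale)
    also have "\<dots> \<le> 2 * t * (d \<bullet> d) + t\<^sup>2 * (q d + 1)" by (simp add: algebra_simps)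
    also have "t\<^sup>2 * (q d + 1) = t * - (d \<bullet> d)"
      using qd unfolding power2_eq_square mult.assoc by (simp add: t_def)
    also have "2 * t * (d \<bullet> d) + t * - (d \<bullet> d) = t * (d \<bullet> d)" by simp
    also have "\<dots> < 0" using pos qd by (simp add: t_def divide_neg_pos mult_neg_pos)
    finally show False by simp
  qed
  then have eig: "A *v u = l *\<^sub>R u" by (simp add: d_def)
  have "l \<noteq> 0"
  proof
    assume "l = 0"
    then have "u \<bullet> u = 0" using eig u(2) unfolding W_def by simp
    then show False using u(1) by simp
  qed
  then have l_pos: "0 < l" using psd[of u] by (simp add: l_def)
  let ?S = "{l. 0 < l \<and> (\<exists>v. v \<noteq> 0 \<and> A *v v = l *\<^sub>R v)}"
  have l_in: "l \<in> ?S" using l_pos eig u(1) by (intro CollectI conjI exI[of _ u]) auto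
  have fin: "finite ?S" by (rule finite_positive_eigenvalues[OF sym])
  \<comment> \<open>\<open>l\<close> is itself a positive eigenvalue, so the bound by
    \<open>l\<close> passes to the minimum.\<close>
  have le: "min_pos_eigenvalue A \<le> l"
    unfolding min_pos_eigenvalue_def by (rule Min_le[OF fin l_in])
  have "min_pos_eigenvalue A \<in> ?S"
    unfolding min_pos_eigenvalue_def using l_in by (intro Min_in fin) blast
  then show "0 < min_pos_eigenvalue A" by simp
  fix u assume "\<And>v. A *v v = 0 \<Longrightarrow> u \<bullet> v = 0"
  then have "0 \<le> q u" by (intro q_nonneg) (simp add: W_def)
  moreover have "min_pos_eigenvalue A * (norm u)\<^sup>2 \<le> l * (norm u)\<^sup>2"
    using le by (intro mult_right_mono) auto
  ultimately show "min_pos_eigenvalue A * (norm u)\<^sup>2 \<le> u \<bullet> (A *v u)"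
    by (simp add: q_def power2_norm_eq_inner)
qed

section \<open>Sample means and conditional laws\<close>

lemma sample_integral_product:
  fixes f :: "'z \<Rightarrow> real"
  assumes D: "prob_space D" and f: "integrable D f" and sq: "integrable D (\<lambda>z. (f z)\<^sup>2)"
    and i: "i < n" and j: "j < n"
  shows "integrable (sample_space n D) (\<lambda>s. f (s i) * f (s j))" (is ?I)
    and "(\<integral>s. f (s i) * f (s j) \<partial>sample_space n D)
      = (if i = j then (\<integral>z. (f z)\<^sup>2 \<partial>D) else (\<integral>z. f z \<partial>D)\<^sup>2)" (is ?E)
proof -
  interpret D: prob_space D by (rule D)
  interpret product_prob_space "\<lambda>_. D" "{..<n}" by unfold_locales
  have "?I \<and> ?E"
  proof (cases "i = j")
    case True
    have distr: "distr (sample_space n D) D (\<lambda>s. s i) = D"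
      unfolding sample_space_def using i D by (intro distr_PiM_component) auto
    have proj: "(\<lambda>s. s i) \<in> measurable (sample_space n D) D"
      unfolding sample_space_def using i by (intro measurable_component_singleton) auto
    have "integrable (distr (sample_space n D) D (\<lambda>s. s i)) (\<lambda>z. (f z)\<^sup>2)" using sq distr by simp
    then have "integrable (sample_space n D) (\<lambda>s. (f (s i))\<^sup>2)"
      by (rule integrable_distr[OF proj])
    moreover have "(\<integral>s. (f (s i))\<^sup>2 \<partial>sample_space n D) = (\<integral>z. (f z)\<^sup>2 \<partial>D)"
      using integral_distr[OF proj, of "\<lambda>z. (f z)\<^sup>2"] sq unfolding distr by simp
    ultimately show ?thesis using True by (simp add: power2_eq_square)
  next
    case False
    \<comment> \<open>Padding with the constant 1, whose integral is 1, turns the product over two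
      distinct coordinates into one over all of them, where the product measure factorizes.\<close>
    define F where "F = (\<lambda>k z. if k = i \<or> k = j then f z else 1)"
    have F: "integrable D (F k)" for k
      using f by (cases "k = i \<or> k = j") (auto simp: F_def)
    have prod: "(\<Prod>k\<in>{..<n}. h k) = h i * h j" if "\<And>k. k \<noteq> i \<Longrightarrow> k \<noteq> j \<Longrightarrow> h k = 1" for h :: "nat \<Rightarrow> real"
    proof -
      have "(\<Prod>k\<in>{..<n}. h k) = (\<Prod>k\<in>{i, j}. h k)"
        using i j that by (intro prod.mono_neutral_right) auto
      then show ?thesis using False by simp
    qed
    have prodF: "(\<Prod>k\<in>{..<n}. F k (s k)) = f (s i) * f (s j)" for s
      by (subst prod) (auto simp: F_def)
    have "integrable (sample_space n D) (\<lambda>s. \<Prod>k\<in>{..<n}. F k (s k))"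
      unfolding sample_space_def by (intro product_integrable_prod F) auto
    moreover have "(\<integral>s. (\<Prod>k\<in>{..<n}. F k (s k)) \<partial>sample_space n D) = (\<Prod>k\<in>{..<n}. \<integral>z. F k z \<partial>D)"
      unfolding sample_space_def by (intro product_integral_prod F) auto
    moreover have "(\<Prod>k\<in>{..<n}. \<integral>z. F k z \<partial>D) = (\<integral>z. f z \<partial>D) * (\<integral>z. f z \<partial>D)"
      by (subst prod) (auto simp: F_def D.prob_space)
    ultimately show ?thesis using False unfolding prodF by (simp add: power2_eq_square)
  qed
  then show ?I ?E by auto
qed

text \<open>The second moment of a sample mean is the squared mean plus the variance over
  \<open>n\<close>; the squared mean is dropped. The variance is written as a product to match a
  diagonal entry of \<open>covariance_matrix\<close>.\<close>

lemma sample_mean_second_moment: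
  fixes f :: "'z \<Rightarrow> real"
  assumes D: "prob_space D" and f: "integrable D f" and sq: "integrable D (\<lambda>z. (f z)\<^sup>2)" and "1 \<le> n"
  shows "integrable (sample_space n D) (\<lambda>s. (1 / real n * (\<Sum>i<n. f (s i)))\<^sup>2)"
    and "(\<integral>z. (f z - (\<integral>y. f y \<partial>D)) * (f z - (\<integral>y. f y \<partial>D)) \<partial>D) * (1 / real n)
      \<le> (\<integral>s. (1 / real n * (\<Sum>i<n. f (s i)))\<^sup>2 \<partial>sample_space n D)"
proof -
  interpret D: prob_space D by (rule D)
  define m where "m = (\<integral>z. f z \<partial>D)"
  define a where "a = (\<integral>z. (f z)\<^sup>2 \<partial>D)"
  note P = sample_integral_product[OF D f sq]
  have expand: "(1 / real n * (\<Sum>i<n. f (s i)))\<^sup>2 = (1 / real n)\<^sup>2 * (\<Sum>i<n. \<Sum>j<n. f (s i) * f (s j))" for s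
    by (simp only: power_mult_distrib power2_eq_square[of "\<Sum>i<n. f (s i)"] sum_product)
  show "integrable (sample_space n D) (\<lambda>s. (1 / real n * (\<Sum>i<n. f (s i)))\<^sup>2)"
    unfolding expand by (intro Bochner_Integration.integrable_mult_right Bochner_Integration.integrable_sum P) auto
  have "(\<integral>s. (\<Sum>i<n. \<Sum>j<n. f (s i) * f (s j)) \<partial>sample_space n D)
      = (\<Sum>i<n. \<integral>s. (\<Sum>j<n. f (s i) * f (s j)) \<partial>sample_space n D)"
    by (rule Bochner_Integration.integral_sum) (intro Bochner_Integration.integrable_sum P, auto)
  also have "\<dots> = (\<Sum>i<n. \<Sum>j<n. \<integral>s. f (s i) * f (s j) \<partial>sample_space n D)"
    by (intro sum.cong refl Bochner_Integration.integral_sum P) auto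
  also have "\<dots> = (\<Sum>i<n. \<Sum>j<n. m\<^sup>2 + (if i = j then a - m\<^sup>2 else 0))"
    by (intro sum.cong refl) (simp add: P m_def a_def)
  also have "\<dots> = (real n)\<^sup>2 * m\<^sup>2 + real n * (a - m\<^sup>2)"
    by (simp add: sum.distrib power2_eq_square distrib_left)
  finally have E: "(\<integral>s. (1 / real n * (\<Sum>i<n. f (s i)))\<^sup>2 \<partial>sample_space n D) = m\<^sup>2 + (a - m\<^sup>2) / real n"
    using \<open>1 \<le> n\<close> unfolding expand by (simp add: power2_eq_square field_simps)
  have "(\<integral>z. (f z - m) * (f z - m) \<partial>D) = (\<integral>z. (f z)\<^sup>2 - 2 * m * f z + m\<^sup>2 \<partial>D)"
    by (intro Bochner_Integration.integral_cong) (auto simp: power2_eq_square algebra_simps)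
  also have "\<dots> = a - 2 * m * m + m\<^sup>2"
    using f sq by (simp add: a_def m_def D.prob_space)
  finally have "(\<integral>z. (f z - m) * (f z - m) \<partial>D) = a - m\<^sup>2" by (simp add: power2_eq_square)
  then show "(\<integral>z. (f z - (\<integral>y. f y \<partial>D)) * (f z - (\<integral>y. f y \<partial>D)) \<partial>D) * (1 / real n)
      \<le> (\<integral>s. (1 / real n * (\<Sum>i<n. f (s i)))\<^sup>2 \<partial>sample_space n D)"
    unfolding E m_def[symmetric] by simp
qed

text \<open>\<open>conditional_law\<close> speaks only of rectangles \<open>A \<times> {k}\<close>.
  For fixed \<open>k\<close> these identify the projected slice of \<open>D\<close> with the measure
  of density \<open>P x $ k\<close>; the finitely many slices are then added.\<close>

lemma integral_conditional_law:
  fixes D :: "((real^'x) \<times> 'k::finite) measure"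
  assumes D: "prob_space D" and sets: "sets D = sets (context_space X \<Otimes>\<^sub>M count_space UNIV)"
    and law: "conditional_law X D P"
    and h: "\<And>k. h k \<in> borel_measurable (context_space X)" and bound: "\<And>k x. \<bar>h k x\<bar> \<le> M"
  shows "(\<integral>z. h (snd z) (fst z) \<partial>D) = (\<integral>x. (\<Sum>k\<in>UNIV. P x $ k * h k x) \<partial>marginal_x X D)"
proof -
  interpret D: prob_space D by (rule D)
  have [measurable]: "h k \<in> borel_measurable (context_space X)" for k by (rule h)
  have P: "P \<in> borel_measurable (context_space X)" "\<And>x. x \<in> X \<Longrightarrow> P x \<in> prob_simplex"
    "\<And>k A. A \<in> sets (context_space X) \<Longrightarrow> measure D (A \<times> {k}) = (LINT x:A|marginal_x X D. P x $ k)"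
    using law unfolding conditional_law_def by auto
  have fst[measurable]: "fst \<in> measurable D (context_space X)"
    by (simp add: measurable_cong_sets[OF sets refl])
  have snd[measurable]: "snd \<in> measurable D (count_space UNIV)"
    by (simp add: measurable_cong_sets[OF sets refl])
  let ?Dx = "marginal_x X D"
  interpret Dx: prob_space ?Dx unfolding marginal_x_def by (rule D.prob_space_distr[OF fst])
  have space_X: "space (context_space X) = X" by (simp add: context_space_def space_restrict_space)
  have space_D: "space D = X \<times> UNIV"
    using sets_eq_imp_space_eq[OF sets] by (simp add: space_pair_measure space_X)
  have Dx_sets [measurable_cong]: "sets ?Dx = sets (context_space X)" by (simp add: marginal_x_def)
  have Dx_space: "space ?Dx = X" by (simp add: marginal_x_def space_X)
  have Pk[measurable]: "(\<lambda>x. P x $ k) \<in> borel_measurable (context_space X)" for k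
    using P(1) by (rule measurable_compose) (intro borel_measurable_continuous_onI continuous_intros)
  have P01: "0 \<le> P x $ k" "P x $ k \<le> 1" if "x \<in> X" for x k
    using P(2)[OF that] member_le_sum[of k UNIV "\<lambda>k. P x $ k"] by (auto simp: prob_simplex_def)
  have int_P: "integrable ?Dx (\<lambda>x. P x $ k)" for k
    by (rule Dx.integrable_const_bound[where B = 1]) (use P01 Dx_space in \<open>auto intro!: AE_I2 simp: Pk\<close>)
  have eq: "distr (density D (\<lambda>z. indicator {k} (snd z))) (context_space X) fst
      = density ?Dx (\<lambda>x. ennreal (P x $ k))" for k
  proof (rule measure_eqI)
    show "sets (distr (density D (\<lambda>z. indicator {k} (snd z))) (context_space X) fst)
        = sets (density ?Dx (\<lambda>x. ennreal (P x $ k)))" by (simp add: Dx_sets)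
    fix A assume "A \<in> sets (distr (density D (\<lambda>z. indicator {k} (snd z))) (context_space X) fst)"
    then have A[measurable]: "A \<in> sets (context_space X)" by simp
    have AX: "A \<subseteq> X" using sets.sets_into_space[OF A] space_X by simp
    have "A \<times> {k} \<in> sets D" unfolding sets by measurable
    have "emeasure (distr (density D (\<lambda>z. indicator {k} (snd z))) (context_space X) fst) A
        = (\<integral>\<^sup>+z. indicator {k} (snd z) * indicator (fst -` A \<inter> space D) z \<partial>D)"
      by (subst emeasure_distr) (auto simp: emeasure_density)
    also have "\<dots> = (\<integral>\<^sup>+z. indicator (A \<times> {k}) z \<partial>D)"
      by (intro nn_integral_cong) (auto simp: indicator_def)
    also have "\<dots> = ennreal (measure D (A \<times> {k}))"
      using \<open>A \<times> {k} \<in> sets D\<close> by (simp add: D.emeasure_eq_measure)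
    also have "\<dots> = ennreal (\<integral>x. indicator A x * P x $ k \<partial>?Dx)"
      using P(3)[OF A] by (simp add: set_lebesgue_integral_def)
    also have "\<dots> = (\<integral>\<^sup>+x. ennreal (indicator A x * P x $ k) \<partial>?Dx)"
    proof (rule nn_integral_eq_integral[symmetric])
      show "integrable ?Dx (\<lambda>x. indicator A x * P x $ k)"
        using integrable_real_mult_indicator[of A ?Dx "\<lambda>x. P x $ k"] int_P A
        by (simp add: Dx_sets mult.commute)
    qed (use P01 Dx_space in \<open>auto simp: indicator_def\<close>)
    also have "\<dots> = emeasure (density ?Dx (\<lambda>x. ennreal (P x $ k))) A"
      by (subst emeasure_density) (auto simp: Dx_sets A indicator_def intro!: nn_integral_cong)
    finally show "emeasure (distr (density D (\<lambda>z. indicator {k} (snd z))) (context_space X) fst) A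
        = emeasure (density ?Dx (\<lambda>x. ennreal (P x $ k))) A" .
  qed
  have slice: "(\<integral>z. indicator {k} (snd z) * h k (fst z) \<partial>D) = (\<integral>x. P x $ k * h k x \<partial>?Dx)" for k
  proof -
    have "(\<integral>z. indicator {k} (snd z) * h k (fst z) \<partial>D)
        = (\<integral>z. h k (fst z) \<partial>density D (\<lambda>z. ennreal (indicator {k} (snd z))))"
      by (subst integral_density) auto
    also have "\<dots> = (\<integral>x. h k x \<partial>distr (density D (\<lambda>z. indicator {k} (snd z))) (context_space X) fst)"
      by (subst integral_distr) (auto simp: ennreal_indicator)
    also have "\<dots> = (\<integral>x. P x $ k * h k x \<partial>?Dx)"
      unfolding eq using P01 Dx_space by (subst integral_density) (auto intro!: AE_I2)
    finally show ?thesis .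
  qed
  have M: "0 \<le> M" using bound[of undefined undefined] by linarith
  have "(\<integral>z. h (snd z) (fst z) \<partial>D) = (\<integral>z. (\<Sum>k\<in>UNIV. indicator {k} (snd z) * h k (fst z)) \<partial>D)"
    by (intro Bochner_Integration.integral_cong refl) (simp add: indicator_def if_distrib cong: if_cong)
  also have "\<dots> = (\<Sum>k\<in>UNIV. \<integral>z. indicator {k} (snd z) * h k (fst z) \<partial>D)"
    by (intro Bochner_Integration.integral_sum D.integrable_const_bound[where B = M])
      (use bound M in \<open>auto simp: indicator_def\<close>)
  also have "\<dots> = (\<Sum>k\<in>UNIV. \<integral>x. P x $ k * h k x \<partial>?Dx)" by (simp add: slice)
  also have "\<dots> = (\<integral>x. (\<Sum>k\<in>UNIV. P x $ k * h k x) \<partial>?Dx)"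
  proof (intro Bochner_Integration.integral_sum[symmetric] Dx.integrable_const_bound[where B = M] AE_I2)
    fix k x assume "x \<in> space ?Dx"
    then have "\<bar>P x $ k\<bar> * \<bar>h k x\<bar> \<le> 1 * M"
      using P01[of x k] bound[of k x] Dx_space by (intro mult_mono) auto
    then show "norm (P x $ k * h k x) \<le> M" by (simp add: abs_mult)
  qed auto
  finally show ?thesis .
qed

section \<open>Linear logit models\<close>

declare transpose_matrix_vector [simp del]

definition outer :: "real^'p \<Rightarrow> real^'k \<Rightarrow> real^'k^'p" where
  "outer x y = (\<chi> i j. x $ i * y $ j)"

lemma transpose_mult_nth: "(transpose \<Theta> *v x) $ k = column k \<Theta> \<bullet> x"
  by (simp add: matrix_vector_mult_def transpose_def column_def inner_vec_def)

text \<open>Identifies the adjoint of \<open>\<Theta> \<mapsto> transpose \<Theta> *v x\<close> for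
  the Frobenius inner product; gradients in the parameters are therefore outer products with the
  feature vector.\<close>

lemma inner_outer: "Z \<bullet> outer x y = (transpose Z *v x) \<bullet> y" for Z :: "real^'k^'p"
proof -
  have "Z \<bullet> outer x y = (\<Sum>i\<in>UNIV. \<Sum>j\<in>UNIV. Z $ i $ j * x $ i * y $ j)"
    by (simp add: inner_vec_def outer_def mult.assoc)
  also have "\<dots> = (\<Sum>j\<in>UNIV. \<Sum>i\<in>UNIV. Z $ i $ j * x $ i * y $ j)"
    by (rule sum.swap)
  also have "\<dots> = (transpose Z *v x) \<bullet> y"
    by (simp add: inner_vec_def matrix_vector_mult_def transpose_def sum_distrib_right)
  finally show ?thesis .
qed

lemma linear_transpose_mult: "linear (\<lambda>\<Theta>::real^'k^'p. transpose \<Theta> *v x)"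
  by (intro linearI)
    (simp_all add: vec_eq_iff transpose_mult_nth column_def inner_vec_def sum.distrib sum_distrib_left algebra_simps)

lemma bounded_linear_transpose_mult: "bounded_linear (\<lambda>\<Theta>::real^'k^'p. transpose \<Theta> *v x)"
  using linear_transpose_mult by (simp add: linear_conv_bounded_linear)

lemma continuous_on_transpose_mult [continuous_intros]:
  fixes f :: "'a::topological_space \<Rightarrow> real^'k^'p"
  assumes "continuous_on S f" "continuous_on S g"
  shows "continuous_on S (\<lambda>z. transpose (f z) *v g z)"
  unfolding matrix_vector_mult_def transpose_def
  by simp (intro continuous_intros assms)

lemma power2_norm_columns: "(norm M)\<^sup>2 = (\<Sum>k\<in>UNIV. (norm (column k M))\<^sup>2)" for M :: "real^'k^'p"
proof -
  have "(norm M)\<^sup>2 = (\<Sum>i\<in>UNIV. \<Sum>k\<in>UNIV. M $ i $ k * M $ i $ k)"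
    unfolding power2_norm_eq_inner by (simp add: inner_vec_def)
  also have "\<dots> = (\<Sum>k\<in>UNIV. \<Sum>i\<in>UNIV. M $ i $ k * M $ i $ k)" by (rule sum.swap)
  also have "\<dots> = (\<Sum>k\<in>UNIV. (norm (column k M))\<^sup>2)"
    unfolding power2_norm_eq_inner by (simp add: inner_vec_def column_def)
  finally show ?thesis .
qed

lemma norm_vectorize: "norm (vectorize M) = norm M" for M :: "real^'k^'p"
proof -
  have "(norm (vectorize M))\<^sup>2 = (\<Sum>ik\<in>UNIV \<times> UNIV. M $ fst ik $ snd ik * M $ fst ik $ snd ik)"
    unfolding power2_norm_eq_inner by (simp add: inner_vec_def vectorize_def)
  also have "\<dots> = (\<Sum>i\<in>UNIV. \<Sum>k\<in>UNIV. M $ i $ k * M $ i $ k)"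
    by (simp add: sum.cartesian_product case_prod_beta)
  also have "\<dots> = (norm M)\<^sup>2"
    unfolding power2_norm_eq_inner by (simp add: inner_vec_def)
  finally show ?thesis by simp
qed

lemma GDERIV_linear_model:
  fixes x :: "real^'p" and f :: "real^'k \<Rightarrow> real"
  assumes "GDERIV f (transpose \<Theta> *v x) :> g"
  shows "GDERIV (\<lambda>\<Theta>. f (transpose \<Theta> *v x)) \<Theta> :> outer x g"
  unfolding gderiv_def inner_outer
  by (rule has_derivative_compose[OF bounded_linear.has_derivative[OF bounded_linear_transpose_mult has_derivative_ident]
        assms[unfolded gderiv_def]])

text \<open>A column holds the weights of one logit, so being invisible to the features is a
  condition on each column, and orthogonal projection is applied columnwise.\<close>

lemma matrix_column_decomposition:
  fixes M :: "real^'k^'p"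
  assumes N: "subspace N"
  obtains Y Z where "M = Y + Z" "\<And>k. column k Z \<in> N" "\<And>k v. v \<in> N \<Longrightarrow> column k Y \<bullet> v = 0"
proof -
  have "\<exists>z y. z \<in> N \<and> (\<forall>v\<in>N. y \<bullet> v = 0) \<and> column k M = y + z" for k
  proof -
    from orthogonal_subspace_decomp_exists[of N "column k M"] obtain z y where
      "z \<in> span N" "\<And>v. v \<in> span N \<Longrightarrow> orthogonal y v" "column k M = z + y" by blast
    then show ?thesis using N by (intro exI[of _ z] exI[of _ y]) (auto simp: orthogonal_def span_eq_iff[THEN iffD2])
  qed
  then obtain z y where zy: "\<And>k. z k \<in> N" "\<And>k v. v \<in> N \<Longrightarrow> y k \<bullet> v = 0" "\<And>k. column k M = y k + z k"
    by metis
  show thesis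
  proof (rule that[of "\<chi> i k. y k $ i" "\<chi> i k. z k $ i"])
    show "M = (\<chi> i k. y k $ i) + (\<chi> i k. z k $ i)"
      using zy(3) by (simp add: vec_eq_iff column_def)
    show "column k (\<chi> i k. z k $ i) \<in> N" for k
      using zy(1)[of k] by (simp add: column_def vec_lambda_eta)
    show "v \<in> N \<Longrightarrow> column k (\<chi> i k. y k $ i) \<bullet> v = 0" for k v
      using zy(2)[of v k] by (simp add: column_def vec_lambda_eta)
  qed
qed

text \<open>The gradient does not change along \<open>z\<close>, so the Hessian annihilates \<open>z\<close> and only the component
  \<open>y\<close> of the displacement contributes.\<close>

lemma gradient_bound_modulo_invariance:
  fixes f :: "'a::real_inner \<Rightarrow> real"
  assumes hess: "\<And>x. x \<in> closed_segment a b \<Longrightarrow>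
      \<exists>H. has_hessian f H x \<and> loewner_le (\<lambda>v. (- M) *\<^sub>R v) H \<and> loewner_le H (\<lambda>v. M *\<^sub>R v)"
    and b: "b - a = y + z" and invariant: "\<And>x t. grad f (x + t *\<^sub>R z) = grad f x"
    and stationary: "grad f b = 0"
  shows "norm (grad f a) \<le> M * norm y"
proof -
  obtain H where H: "\<And>x. x \<in> closed_segment a b \<Longrightarrow> has_hessian f (H x) x"
    "\<And>x. x \<in> closed_segment a b \<Longrightarrow> loewner_le (\<lambda>v. (- M) *\<^sub>R v) (H x)"
    "\<And>x. x \<in> closed_segment a b \<Longrightarrow> loewner_le (H x) (\<lambda>v. M *\<^sub>R v)"
    using hess by metis
  have der: "(grad f has_derivative H x) (at x)" if "x \<in> closed_segment a b" for x
    using H(1)[OF that] by (simp add: has_hessian_def)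
  have lin: "linear (H x)" if "x \<in> closed_segment a b" for x
    using der[OF that] by (rule has_derivative_linear)
  have Hz: "H x z = 0" if "x \<in> closed_segment a b" for x
  proof -
    have "((\<lambda>t. grad f (x + t *\<^sub>R z) \<bullet> H x z) has_real_derivative (H x z \<bullet> H x z)) (at 0)"
      by (rule has_derivative_along_line) (simp add: der that)
    then have "((\<lambda>t. grad f x \<bullet> H x z) has_real_derivative (H x z \<bullet> H x z)) (at 0)"
      by (simp only: invariant)
    then have "H x z \<bullet> H x z = 0" using DERIV_const by (rule DERIV_unique)
    then show ?thesis by simp
  qed
  \<comment> \<open>Testing against the gradient at \<open>a\<close> itself reduces a vector-valued
    increment to a scalar mean value argument; one factor \<open>norm w\<close> cancels at the
    end.\<close>
  define w where "w = grad f a"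
  have seg: "a + t *\<^sub>R (b - a) \<in> closed_segment a b" if "0 \<le> t" "t \<le> 1" for t
    using that unfolding in_segment by (intro exI[of _ t]) (simp add: algebra_simps)
  have "((\<lambda>t. grad f (a + t *\<^sub>R (b - a)) \<bullet> w) has_real_derivative (H (a + t *\<^sub>R (b - a)) (b - a) \<bullet> w)) (at t)"
    if "0 \<le> t" "t \<le> 1" for t
    by (rule has_derivative_along_line) (rule der[OF seg[OF that]])
  from MVT2[OF zero_less_one this] obtain t where t: "0 < t" "t < 1"
    and eq: "grad f (a + 1 *\<^sub>R (b - a)) \<bullet> w - grad f (a + 0 *\<^sub>R (b - a)) \<bullet> w
        = (1 - 0) * (H (a + t *\<^sub>R (b - a)) (b - a) \<bullet> w)" by blast
  define x where "x = a + t *\<^sub>R (b - a)"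
  have x: "x \<in> closed_segment a b" unfolding x_def using t by (intro seg) auto
  have "H x (b - a) = H x y" unfolding b by (simp add: linear_add[OF lin[OF x]] Hz[OF x])
  then have "w \<bullet> w = - (H x y \<bullet> w)"
    using eq stationary unfolding x_def[symmetric] by (simp add: w_def)
  also have "\<dots> \<le> norm (H x y) * norm w" using Cauchy_Schwarz_ineq2[of "H x y" w] by linarith
  also have "\<dots> \<le> (M * norm y) * norm w"
    by (intro mult_right_mono self_adjoint_norm_bound lin x H(2,3) hessian_symmetric[OF H(1)]) simp
  finally have "norm w * norm w \<le> (M * norm y) * norm w"
    by (simp add: power2_norm_eq_inner[symmetric] power2_eq_square)
  moreover have "0 \<le> M * norm y"
    using self_adjoint_norm_bound[OF lin[OF x] hessian_symmetric[OF H(1)[OF x]] H(2,3)[OF x], of y]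
      norm_ge_zero order_trans by blast
  ultimately show ?thesis unfolding w_def by (cases "grad f a = 0") auto
qed

section \<open>Gradients of the empirical risk\<close>

context convex_cost
begin

definition example_grad :: "(real^'x \<Rightarrow> real^'p) \<Rightarrow> real^'k^'p \<Rightarrow> (real^'x) \<times> 'k \<Rightarrow> real^'k^'p" where
  "example_grad \<phi> \<Theta> z
     = outer (\<phi> (fst z)) (grad (logit_cost (snd z)) (transpose \<Theta> *v \<phi> (fst z)))"

lemma cost_policy: "c (policy c \<phi> \<Theta> x) k = logit_cost k (transpose \<Theta> *v \<phi> x)"
  by (simp add: policy_def model_def logit_cost_def)

lemma GDERIV_policy_cost: "GDERIV (\<lambda>\<Theta>. c (policy c \<phi> \<Theta> (fst z)) (snd z)) \<Theta> :> example_grad \<phi> \<Theta> z"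
  unfolding cost_policy example_grad_def by (intro GDERIV_linear_model GDERIV_logit_cost)

lemma score_eq: "score c \<phi> \<Theta> z = vectorize (example_grad \<phi> \<Theta> z)"
  unfolding score_def by (simp add: grad_eq[OF GDERIV_policy_cost])

lemma GDERIV_empirical_risk:
  "GDERIV (empirical_risk c \<phi> n s) \<Theta> :> (1 / real n) *\<^sub>R (\<Sum>i<n. example_grad \<phi> \<Theta> (s i))"
  unfolding empirical_risk_def[abs_def] by (intro GDERIV_cmult GDERIV_sum GDERIV_policy_cost)

text \<open>Softmax ignores adding a constant to all logits, so the constraint on the parameters is inactive.\<close>

lemma empirical_risk_stationary:
  fixes \<Theta>\<^sub>0 :: "real^'k^'p"
  assumes min: "is_arg_min (empirical_risk c \<phi> n s) (\<lambda>\<Theta>. \<Theta> \<in> centered) \<Theta>\<^sub>0"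
  shows "grad (empirical_risk c \<phi> n s) \<Theta>\<^sub>0 = 0"
proof -
  have "empirical_risk c \<phi> n s \<Theta>\<^sub>0 \<le> empirical_risk c \<phi> n s \<Theta>" for \<Theta>
  proof -
    \<comment> \<open>The vector of row means of \<open>\<Theta>\<close>; subtracting it from every
      column centres the parameters and shifts all logits at \<open>x\<close> by the same
      \<open>a \<bullet> x\<close>.\<close>
    define a where "a = (1 / real CARD('k)) *\<^sub>R (\<Theta> *v 1)"
    define \<Theta>' where "\<Theta>' = \<Theta> - outer a 1"
    have "\<Theta>' \<in> centered"
      by (simp add: centered_def \<Theta>'_def a_def outer_def vec_eq_iff matrix_vector_mult_def sum_subtractf)
    moreover have "transpose \<Theta> *v x = transpose \<Theta>' *v x + (a \<bullet> x) *\<^sub>R 1" for x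
      by (simp add: vec_eq_iff transpose_mult_nth column_def \<Theta>'_def outer_def inner_vec_def
          sum.distrib[symmetric] algebra_simps)
    then have "empirical_risk c \<phi> n s \<Theta> = empirical_risk c \<phi> n s \<Theta>'"
      by (simp add: empirical_risk_def cost_policy logit_cost_shift)
    ultimately show ?thesis using min by (simp add: is_arg_min_linorder)
  qed
  from GDERIV_minimum[OF GDERIV_empirical_risk this] show ?thesis
    by (simp add: grad_eq[OF GDERIV_empirical_risk])
qed

lemma empirical_gradient_bound:
  assumes hess: "\<And>\<Theta>. \<Theta> \<in> closed_segment \<Theta>\<^sub>1 \<Theta>\<^sub>0 \<Longrightarrow> \<exists>H. has_hessian (empirical_risk c \<phi> n s) H \<Theta>
      \<and> loewner_le (\<lambda>V. (- M) *\<^sub>R V) H \<and> loewner_le H (\<lambda>V. M *\<^sub>R V)"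
    and min: "is_arg_min (empirical_risk c \<phi> n s) (\<lambda>\<Theta>. \<Theta> \<in> centered) \<Theta>\<^sub>0"
    and split: "\<Theta>\<^sub>0 - \<Theta>\<^sub>1 = Y + Z"
    and invisible: "\<And>i. i < n \<Longrightarrow> transpose Z *v \<phi> (fst (s i)) = 0"
  shows "norm ((1 / real n) *\<^sub>R (\<Sum>i<n. example_grad \<phi> \<Theta>\<^sub>1 (s i))) \<le> M * norm Y"
proof -
  have "example_grad \<phi> (\<Theta> + t *\<^sub>R Z) (s i) = example_grad \<phi> \<Theta> (s i)" if "i < n" for \<Theta> t i
    using invisible[OF that]
    by (simp add: example_grad_def linear_add[OF linear_transpose_mult] linear_scale[OF linear_transpose_mult])
  then have "grad (empirical_risk c \<phi> n s) (\<Theta> + t *\<^sub>R Z) = grad (empirical_risk c \<phi> n s) \<Theta>" for \<Theta> t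
    by (simp add: grad_eq[OF GDERIV_empirical_risk])
  from gradient_bound_modulo_invariance[OF hess split this empirical_risk_stationary[OF min]]
  show ?thesis by (simp add: grad_eq[OF GDERIV_empirical_risk])
qed

end

section \<open>Second moments of features\<close>

lemma integrable_inner:
  fixes u v :: "'a \<Rightarrow> 'b::euclidean_space"
  assumes [measurable]: "u \<in> borel_measurable M" "v \<in> borel_measurable M"
    and u: "integrable M (\<lambda>x. (norm (u x))\<^sup>2)" and v: "integrable M (\<lambda>x. (norm (v x))\<^sup>2)"
  shows "integrable M (\<lambda>x. u x \<bullet> v x)"
proof (rule Bochner_Integration.integrable_bound[OF Bochner_Integration.integrable_add[OF u v]])
  show "AE x in M. norm (u x \<bullet> v x) \<le> norm ((norm (u x))\<^sup>2 + (norm (v x))\<^sup>2)"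
  proof (rule AE_I2)
    fix x
    have "2 * (norm (u x) * norm (v x)) \<le> (norm (u x))\<^sup>2 + (norm (v x))\<^sup>2"
      using sum_squares_bound[of "norm (u x)" "norm (v x)"] by simp
    moreover have "0 \<le> norm (u x) * norm (v x)" by simp
    ultimately show "norm (u x \<bullet> v x) \<le> norm ((norm (u x))\<^sup>2 + (norm (v x))\<^sup>2)"
      using Cauchy_Schwarz_ineq2[of "u x" "v x"] by simp
  qed
qed measurable

lemma borel_measurable_vec_nth [measurable]:
  "f \<in> borel_measurable M \<Longrightarrow> (\<lambda>x. (f x :: 'b::euclidean_space^'n) $ i) \<in> borel_measurable M"
  by (erule measurable_compose) (intro borel_measurable_continuous_onI continuous_intros)

lemma borel_measurable_transpose_mult [measurable (raw)]:
  fixes f :: "'a \<Rightarrow> real^'k^'p"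
  assumes "f \<in> borel_measurable M" "g \<in> borel_measurable M"
  shows "(\<lambda>z. transpose (f z) *v g z) \<in> borel_measurable M"
  using assms
  by (rule borel_measurable_continuous_Pair) (intro continuous_intros)

lemma borel_measurable_outcome:
  fixes h :: "'k::finite \<Rightarrow> 'a \<Rightarrow> real"
  assumes [measurable]: "\<And>k. h k \<in> borel_measurable M" "g \<in> measurable M (count_space UNIV)"
  shows "(\<lambda>z. h (g z) z) \<in> borel_measurable M"
proof -
  have "(\<lambda>z. \<Sum>k\<in>UNIV. indicator {k} (g z) * h k z) \<in> borel_measurable M" by measurable
  moreover have "(\<Sum>k\<in>UNIV. indicator {k} (g z) * h k z) = h (g z) z" for z
    by (simp add: indicator_def if_distrib cong: if_cong)
  ultimately show ?thesis by simp
qed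

locale feature_law = prob_space M for M :: "(real^'x) measure" +
  fixes \<phi> :: "real^'x \<Rightarrow> real^'p"
  assumes feature_measurable [measurable]: "\<phi> \<in> borel_measurable M"
    and feature_sq: "integrable M (\<lambda>x. (norm (\<phi> x))\<^sup>2)"
begin

abbreviation \<Sigma> :: "real^'p^'p" where "\<Sigma> \<equiv> second_moment M \<phi>"

lemma transpose_mult_sq_integrable: "integrable M (\<lambda>x. (norm (transpose \<Theta> *v \<phi> x))\<^sup>2)"
proof (rule Bochner_Integration.integrable_bound)
  have "linear ((*v) (transpose \<Theta>))" by (rule matrix_vector_mul_linear)
  then have bl: "bounded_linear ((*v) (transpose \<Theta>))" by (simp add: linear_conv_bounded_linear)
  show "integrable M (\<lambda>x. (onorm ((*v) (transpose \<Theta>)))\<^sup>2 * (norm (\<phi> x))\<^sup>2)"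
    using feature_sq by (rule Bochner_Integration.integrable_mult_right)
  show "AE x in M. norm ((norm (transpose \<Theta> *v \<phi> x))\<^sup>2)
      \<le> norm ((onorm ((*v) (transpose \<Theta>)))\<^sup>2 * (norm (\<phi> x))\<^sup>2)"
    using onorm[OF bl] by (auto simp: power_mult_distrib[symmetric] intro!: AE_I2 power_mono)
qed measurable

lemma second_moment_form: "u \<bullet> (\<Sigma> *v v) = (\<integral>x. (u \<bullet> \<phi> x) * (v \<bullet> \<phi> x) \<partial>M)"
proof -
  have int: "integrable M (\<lambda>x. \<phi> x $ i * \<phi> x $ j)" for i j
  proof (rule Bochner_Integration.integrable_bound[OF feature_sq])
    show "AE x in M. norm (\<phi> x $ i * \<phi> x $ j) \<le> norm ((norm (\<phi> x))\<^sup>2)"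
      using component_le_norm_cart by (auto simp: power2_eq_square abs_mult intro!: AE_I2 mult_mono)
  qed measurable
  have "u \<bullet> (\<Sigma> *v v) = (\<Sum>i\<in>UNIV. \<Sum>j\<in>UNIV. u $ i * v $ j * (\<integral>x. \<phi> x $ i * \<phi> x $ j \<partial>M))"
    by (simp add: inner_vec_def matrix_vector_mult_def second_moment_def sum_distrib_left ac_simps)
  also have "\<dots> = (\<integral>x. (\<Sum>i\<in>UNIV. \<Sum>j\<in>UNIV. u $ i * v $ j * (\<phi> x $ i * \<phi> x $ j)) \<partial>M)"
    using int by (simp add: Bochner_Integration.integral_sum Bochner_Integration.integrable_sum)
  also have "\<dots> = (\<integral>x. (u \<bullet> \<phi> x) * (v \<bullet> \<phi> x) \<partial>M)"
    by (simp add: inner_vec_def sum_product ac_simps)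
  finally show ?thesis .
qed

lemma second_moment_symmetric: "u \<bullet> (\<Sigma> *v v) = v \<bullet> (\<Sigma> *v u)"
  unfolding second_moment_form by (simp add: mult.commute)

lemma second_moment_psd: "0 \<le> v \<bullet> (\<Sigma> *v v)"
  unfolding second_moment_form by simp

lemma logit_integral: "(\<integral>x. (norm (transpose \<Delta> *v \<phi> x))\<^sup>2 \<partial>M)
    = (\<Sum>k\<in>UNIV. column k \<Delta> \<bullet> (\<Sigma> *v column k \<Delta>))"
proof -
  have "integrable M (\<lambda>x. (column k \<Delta> \<bullet> \<phi> x)\<^sup>2)" for k
  proof (rule Bochner_Integration.integrable_bound[OF transpose_mult_sq_integrable[of \<Delta>]])
    show "AE x in M. norm ((column k \<Delta> \<bullet> \<phi> x)\<^sup>2) \<le> norm ((norm (transpose \<Delta> *v \<phi> x))\<^sup>2)"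
      unfolding power2_norm_vec transpose_mult_nth
      by (intro AE_I2) (auto intro!: member_le_sum sum_nonneg order_trans[OF _ abs_ge_self])
  qed measurable
  then show ?thesis
    unfolding power2_norm_vec transpose_mult_nth second_moment_form
    by (simp add: Bochner_Integration.integral_sum power2_eq_square)
qed

text \<open>For each kernel vector the projected features have zero second moment, but the null set
  depends on the vector. A finite basis of the kernel gives one null set for all.\<close>

lemma features_orthogonal_kernel: "AE x in M. \<forall>v. \<Sigma> *v v = 0 \<longrightarrow> v \<bullet> \<phi> x = 0"
proof -
  have one: "AE x in M. v \<bullet> \<phi> x = 0" if "\<Sigma> *v v = 0" for v
  proof -
    have "integrable M (\<lambda>x. (v \<bullet> \<phi> x) * (v \<bullet> \<phi> x))"
    proof (rule Bochner_Integration.integrable_bound[OF Bochner_Integration.integrable_mult_right[OF feature_sq, of "(norm v)\<^sup>2"]])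
      show "AE x in M. norm ((v \<bullet> \<phi> x) * (v \<bullet> \<phi> x)) \<le> norm ((norm v)\<^sup>2 * (norm (\<phi> x))\<^sup>2)"
      proof (rule AE_I2)
        fix x
        have "\<bar>v \<bullet> \<phi> x\<bar> * \<bar>v \<bullet> \<phi> x\<bar> \<le> (norm v * norm (\<phi> x)) * (norm v * norm (\<phi> x))"
          by (intro mult_mono Cauchy_Schwarz_ineq2) auto
        then show "norm ((v \<bullet> \<phi> x) * (v \<bullet> \<phi> x)) \<le> norm ((norm v)\<^sup>2 * (norm (\<phi> x))\<^sup>2)"
          by (simp add: abs_mult power2_eq_square ac_simps)
      qed
    qed measurable
    moreover have "(\<integral>x. (v \<bullet> \<phi> x) * (v \<bullet> \<phi> x) \<partial>M) = 0"
      unfolding second_moment_form[symmetric] that by simp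
    ultimately have "AE x in M. (v \<bullet> \<phi> x) * (v \<bullet> \<phi> x) = 0"
      by (subst (asm) integral_nonneg_eq_0_iff_AE) auto
    then show ?thesis by simp
  qed
  obtain N where N: "N \<subseteq> {v. \<Sigma> *v v = 0}" "independent N" "{v. \<Sigma> *v v = 0} \<subseteq> span N"
    by (rule basis_exists[of "{v. \<Sigma> *v v = 0}"])
  have "AE x in M. \<forall>v\<in>N. v \<bullet> \<phi> x = 0"
    using N one independent_imp_finite[OF N(2)] by (subst AE_finite_all) auto
  then show ?thesis
  proof (rule AE_mp, intro AE_I2 impI allI)
    fix x v assume "\<forall>v\<in>N. v \<bullet> \<phi> x = 0" and "\<Sigma> *v v = 0"
    moreover have "subspace {v. v \<bullet> \<phi> x = 0}"
      by (auto simp: subspace_def inner_add_left)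
    ultimately show "v \<bullet> \<phi> x = 0"
      using N(3) span_minimal[of N "{v. v \<bullet> \<phi> x = 0}"] by blast
  qed
qed

lemma kernel_subspace: "subspace {v. \<Sigma> *v v = 0}"
  by (auto simp: subspace_def matrix_vector_right_distrib matrix_vector_mult_scaleR)

text \<open>\<open>\<Sigma>\<close> annihilates the columns of \<open>Z\<close> and, by symmetry,
  the cross terms, so the integral sees only \<open>Y\<close>, to which the eigenvalue bound applies
  column by column.\<close>

lemma logit_integral_ge:
  fixes Y Z :: "real^'k^'p"
  assumes Z: "\<And>k. \<Sigma> *v column k Z = 0" and Y: "\<And>k v. \<Sigma> *v v = 0 \<Longrightarrow> column k Y \<bullet> v = 0"
    and nontrivial: "\<exists>u. u \<noteq> 0 \<and> (\<forall>v. \<Sigma> *v v = 0 \<longrightarrow> u \<bullet> v = 0)"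
  shows "min_pos_eigenvalue \<Sigma> * (norm Y)\<^sup>2 \<le> (\<integral>x. (norm (transpose (Y + Z) *v \<phi> x))\<^sup>2 \<partial>M)"
proof -
  have col: "column k (Y + Z) = column k Y + column k Z" for k
    by (simp add: column_def vec_eq_iff)
  have "column k (Y + Z) \<bullet> (\<Sigma> *v column k (Y + Z)) = column k Y \<bullet> (\<Sigma> *v column k Y)" for k
    unfolding col
    by (simp add: matrix_vector_right_distrib Z inner_add_left second_moment_symmetric[of "column k Z"])
  then have "(\<integral>x. (norm (transpose (Y + Z) *v \<phi> x))\<^sup>2 \<partial>M) = (\<Sum>k\<in>UNIV. column k Y \<bullet> (\<Sigma> *v column k Y))"
    unfolding logit_integral by simp
  moreover have "min_pos_eigenvalue \<Sigma> * (norm Y)\<^sup>2 \<le> (\<Sum>k\<in>UNIV. column k Y \<bullet> (\<Sigma> *v column k Y))"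
    unfolding power2_norm_columns sum_distrib_left
    by (intro sum_mono min_pos_eigenvalue_le(2) second_moment_symmetric second_moment_psd nontrivial Y)
  ultimately show ?thesis by simp
qed

lemma logit_error_integrable:
  fixes \<eta> :: "real^'x \<Rightarrow> real^'k"
  assumes \<eta>[measurable]: "\<eta> \<in> borel_measurable M" and \<eta>_sq: "integrable M (\<lambda>x. (norm (\<eta> x))\<^sup>2)"
  shows "integrable M (\<lambda>x. (norm (transpose \<Theta> *v \<phi> x - \<eta> x))\<^sup>2)"
proof -
  let ?u = "\<lambda>x. transpose \<Theta> *v \<phi> x"
  have "integrable M (\<lambda>x. (norm (?u x))\<^sup>2 + (norm (\<eta> x))\<^sup>2 - 2 * (?u x \<bullet> \<eta> x))"
    by (intro Bochner_Integration.integrable_add Bochner_Integration.integrable_diff Bochner_Integration.integrable_mult_right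
        transpose_mult_sq_integrable \<eta>_sq integrable_inner[OF _ _ transpose_mult_sq_integrable \<eta>_sq]) measurable
  moreover have "(norm (?u x - \<eta> x))\<^sup>2 = (norm (?u x))\<^sup>2 + (norm (\<eta> x))\<^sup>2 - 2 * (?u x \<bullet> \<eta> x)" for x
    unfolding power2_norm_eq_inner
    by (simp add: inner_diff_left inner_diff_right inner_commute[of "\<eta> x" "?u x"])
  ultimately show ?thesis by simp
qed

text \<open>Moving from the minimizer in any admissible direction cannot decrease the error, so the cross
  term in the expansion of the square is nonnegative.\<close>

lemma logit_error_ge:
  fixes \<eta> :: "real^'x \<Rightarrow> real^'k"
  assumes \<eta>[measurable]: "\<eta> \<in> borel_measurable M" and \<eta>_sq: "integrable M (\<lambda>x. (norm (\<eta> x))\<^sup>2)"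
    and min: "is_arg_min (logit_error M \<phi> \<eta>) (\<lambda>\<Theta>. \<Theta> \<in> centered) \<Theta>\<^sub>0"
    and \<Theta>: "\<Theta> \<in> centered"
  shows "approx_error M \<phi> \<eta> + (\<integral>x. (norm (transpose (\<Theta> - \<Theta>\<^sub>0) *v \<phi> x))\<^sup>2 \<partial>M)
    \<le> logit_error M \<phi> \<eta> \<Theta>"
proof -
  define r where "r x = transpose \<Theta>\<^sub>0 *v \<phi> x - \<eta> x" for x
  define d where "d x = transpose (\<Theta> - \<Theta>\<^sub>0) *v \<phi> x" for x
  have [measurable]: "r \<in> borel_measurable M" "d \<in> borel_measurable M"
    unfolding r_def[abs_def] d_def[abs_def] by measurable
  have d_sq: "integrable M (\<lambda>x. (norm (d x))\<^sup>2)"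
    unfolding d_def by (rule transpose_mult_sq_integrable)
  have r_sq: "integrable M (\<lambda>x. (norm (r x))\<^sup>2)"
    unfolding r_def by (rule logit_error_integrable[OF \<eta> \<eta>_sq])
  have rd: "integrable M (\<lambda>x. r x \<bullet> d x)"
    by (rule integrable_inner[OF _ _ r_sq d_sq]) measurable
  define b q where "b = (\<integral>x. r x \<bullet> d x \<partial>M)" and "q = (\<integral>x. (norm (d x))\<^sup>2 \<partial>M)"
  have expand: "logit_error M \<phi> \<eta> (\<Theta>\<^sub>0 + t *\<^sub>R (\<Theta> - \<Theta>\<^sub>0)) = logit_error M \<phi> \<eta> \<Theta>\<^sub>0 + 2 * t * b + t\<^sup>2 * q" for t
  proof -
    have "transpose (\<Theta>\<^sub>0 + t *\<^sub>R (\<Theta> - \<Theta>\<^sub>0)) *v \<phi> x - \<eta> x = r x + t *\<^sub>R d x" for x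
      unfolding linear_add[OF linear_transpose_mult] linear_scale[OF linear_transpose_mult] r_def d_def by simp
    then have "logit_error M \<phi> \<eta> (\<Theta>\<^sub>0 + t *\<^sub>R (\<Theta> - \<Theta>\<^sub>0)) = (\<integral>x. (norm (r x + t *\<^sub>R d x))\<^sup>2 \<partial>M)"
      by (simp add: logit_error_def)
    also have "\<dots> = (\<integral>x. (norm (r x))\<^sup>2 + 2 * t * (r x \<bullet> d x) + t\<^sup>2 * (norm (d x))\<^sup>2 \<partial>M)"
      unfolding power2_norm_eq_inner
      by (intro Bochner_Integration.integral_cong refl)
        (simp add: inner_add_left inner_add_right inner_commute[of "d _" "r _"] power2_eq_square distrib_left)
    also have "\<dots> = (\<integral>x. (norm (r x))\<^sup>2 \<partial>M) + 2 * t * b + t\<^sup>2 * q"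
      using r_sq d_sq rd by (simp add: b_def q_def)
    finally show ?thesis by (simp add: logit_error_def r_def)
  qed
  have in_centered: "\<Theta>\<^sub>0 \<in> centered" using min by (simp add: is_arg_min_linorder)
  have "\<Theta>\<^sub>0 + t *\<^sub>R (\<Theta> - \<Theta>\<^sub>0) \<in> centered" for t
    using \<Theta> in_centered
    by (simp add: centered_def matrix_vector_mult_add_rdistrib matrix_vector_mult_diff_rdistrib
        scaleR_matrix_vector_assoc[symmetric])
  then have "logit_error M \<phi> \<eta> \<Theta>\<^sub>0 \<le> logit_error M \<phi> \<eta> (\<Theta>\<^sub>0 + t *\<^sub>R (\<Theta> - \<Theta>\<^sub>0))" for t
    using min unfolding is_arg_min_linorder by blast
  then have step: "0 \<le> 2 * t * b + t\<^sup>2 * q" for t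
    unfolding expand by (simp add: add.assoc)
  have q: "0 \<le> q" by (simp add: q_def)
  have "0 \<le> b"
  proof (rule ccontr)
    assume "\<not> 0 \<le> b"
    then have b: "b < 0" by simp
    \<comment> \<open>At this step size the quadratic term is at most half the size of the negative
      linear term; the 1 in the denominator covers \<open>q = 0\<close>.\<close>
    have "0 \<le> 2 * (- b / (q + 1)) * b + (- b / (q + 1))\<^sup>2 * q" by (rule step)
    also have "\<dots> \<le> 2 * (- b / (q + 1)) * b + (- b / (q + 1))\<^sup>2 * (q + 1)"
      by (intro add_left_mono mult_left_mono) auto
    also have "(- b / (q + 1))\<^sup>2 * (q + 1) = (- b / (q + 1)) * - b"
      using q unfolding power2_eq_square mult.assoc by simp
    also have "2 * (- b / (q + 1)) * b + (- b / (q + 1)) * - b = (- b / (q + 1)) * b" by simp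
    also have "\<dots> < 0" using b q by (intro mult_pos_neg divide_pos_pos) auto
    finally show False by simp
  qed
  moreover have "approx_error M \<phi> \<eta> \<le> logit_error M \<phi> \<eta> \<Theta>\<^sub>0"
    unfolding approx_error_def
    by (intro cINF_lower[OF _ in_centered] bdd_belowI[of _ 0]) (auto simp: logit_error_def)
  ultimately show ?thesis
    using expand[of 1] by (simp add: q_def d_def)
qed

end

section \<open>Excess risk\<close>

locale decision_problem = convex_cost c \<mu> G
  for c :: "real^'d \<Rightarrow> 'k::finite \<Rightarrow> real" and \<mu> G :: real +
  fixes X :: "(real^'x) set" and D :: "((real^'x) \<times> 'k) measure"
    and P \<eta> :: "real^'x \<Rightarrow> real^'k" and \<phi> :: "real^'x \<Rightarrow> real^'p" and B :: real
  assumes data_prob: "prob_space D"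
    and data_sets: "sets D = sets (context_space X \<Otimes>\<^sub>M count_space UNIV)"
    and data_law: "conditional_law X D P"
    and phi_measurable [measurable]: "\<phi> \<in> borel_measurable (context_space X)"
    and phi_sq: "integrable (marginal_x X D) (\<lambda>x. (norm (\<phi> x))\<^sup>2)"
    and eta_measurable [measurable]: "\<eta> \<in> borel_measurable (context_space X)"
    and P_softmax: "\<And>x. x \<in> X \<Longrightarrow> P x = softmax (\<eta> x)"
    and eta_centered: "\<And>x. x \<in> X \<Longrightarrow> \<eta> x \<bullet> 1 = 0"
    and eta_bound: "\<And>x. x \<in> X \<Longrightarrow> infnorm (\<eta> x) \<le> B"
begin

abbreviation "Dx \<equiv> marginal_x X D"

lemma fst_measurable [measurable]: "fst \<in> measurable D (context_space X)"
  by (simp add: measurable_cong_sets[OF data_sets refl])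

lemma snd_measurable [measurable]: "snd \<in> measurable D (count_space UNIV)"
  by (simp add: measurable_cong_sets[OF data_sets refl])

lemma space_context: "space (context_space X) = X"
  by (simp add: context_space_def space_restrict_space)

lemma space_data: "space D = X \<times> UNIV"
  using sets_eq_imp_space_eq[OF data_sets] by (simp add: space_pair_measure space_context)

lemma sets_marginal [measurable_cong]: "sets Dx = sets (context_space X)"
  by (simp add: marginal_x_def)

lemma space_marginal: "space Dx = X"
  by (simp add: marginal_x_def space_context)

sublocale data: prob_space D by (rule data_prob)

sublocale feature_law Dx \<phi>
proof (rule feature_law.intro)
  show "prob_space Dx" unfolding marginal_x_def by (rule data.prob_space_distr) measurable
  show "feature_law_axioms Dx \<phi>"
    using phi_sq by unfold_locales measurable
qed

lemma eta_sq: "integrable Dx (\<lambda>x. (norm (\<eta> x))\<^sup>2)"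
proof (rule integrable_const_bound[where B = "(\<Sum>k\<in>(UNIV::'k set). B)\<^sup>2"])
  show "AE x in Dx. norm ((norm (\<eta> x))\<^sup>2) \<le> (\<Sum>k\<in>(UNIV::'k set). B)\<^sup>2"
  proof (rule AE_I2)
    fix x assume "x \<in> space Dx"
    then have "infnorm (\<eta> x) \<le> B" by (simp add: eta_bound space_marginal)
    then have "norm (\<eta> x) \<le> (\<Sum>k\<in>(UNIV::'k set). B)"
      using component_le_infnorm_cart[of "\<eta> x"]
      by (intro order_trans[OF norm_le_l1_cart] sum_mono) (auto intro: order_trans)
    then show "norm ((norm (\<eta> x))\<^sup>2) \<le> (\<Sum>k\<in>(UNIV::'k set). B)\<^sup>2"
      by (simp add: power_mono)
  qed
qed measurable

definition cost_bound :: real where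
  "cost_bound = (\<Sum>k\<in>UNIV. \<bar>logit_cost k 0\<bar>) + 2 * G\<^sup>2 / \<mu>"

lemma logit_cost_le: "\<bar>logit_cost k u\<bar> \<le> cost_bound"
  using logit_cost_bounded[of k u] member_le_sum[of k UNIV "\<lambda>k. \<bar>logit_cost k 0\<bar>"]
  by (simp add: cost_bound_def)

section \<open>Risks as integrals over contexts\<close>

lemma risk_policy:
  "risk c D (policy c \<phi> \<Theta>) = (\<integral>x. (\<Sum>k\<in>UNIV. P x $ k * logit_cost k (transpose \<Theta> *v \<phi> x)) \<partial>Dx)"
proof -
  have "risk c D (policy c \<phi> \<Theta>) = (\<integral>z. logit_cost (snd z) (transpose \<Theta> *v \<phi> (fst z)) \<partial>D)"
    by (simp add: risk_def cost_policy)
  also have "\<dots> = (\<integral>x. (\<Sum>k\<in>UNIV. P x $ k * logit_cost k (transpose \<Theta> *v \<phi> x)) \<partial>Dx)"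
    by (rule integral_conditional_law[OF data_prob data_sets data_law _ logit_cost_le]) measurable
  finally show ?thesis .
qed

lemma risk_optimal:
  "risk c D (\<lambda>x. opt_action c (P x)) = (\<integral>x. (\<Sum>k\<in>UNIV. P x $ k * logit_cost k (\<eta> x)) \<partial>Dx)"
proof -
  have "risk c D (\<lambda>x. opt_action c (P x)) = (\<integral>z. logit_cost (snd z) (\<eta> (fst z)) \<partial>D)"
    unfolding risk_def
    by (intro Bochner_Integration.integral_cong refl) (auto simp: space_data P_softmax logit_cost_def)
  also have "\<dots> = (\<integral>x. (\<Sum>k\<in>UNIV. P x $ k * logit_cost k (\<eta> x)) \<partial>Dx)"
    by (rule integral_conditional_law[OF data_prob data_sets data_law _ logit_cost_le]) measurable
  finally show ?thesis .
qed

lemma mixed_cost_integrable: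
  assumes [measurable]: "u \<in> borel_measurable Dx"
  shows "integrable Dx (\<lambda>x. \<Sum>k\<in>UNIV. P x $ k * logit_cost k (u x))"
proof (intro Bochner_Integration.integrable_sum integrable_const_bound[where B = "1 * cost_bound"] AE_I2)
  have [measurable]: "P \<in> borel_measurable (context_space X)"
    using data_law by (simp add: conditional_law_def)
  show "(\<lambda>x. P x $ k * logit_cost k (u x)) \<in> borel_measurable Dx" for k by measurable
  fix k x assume "x \<in> space Dx"
  then have "P x \<in> prob_simplex" by (simp add: space_marginal P_softmax softmax_in_simplex)
  then have "0 \<le> P x $ k" "P x $ k \<le> 1"
    using member_le_sum[of k UNIV "\<lambda>k. P x $ k"] by (auto simp: prob_simplex_def)
  then show "norm (P x $ k * logit_cost k (u x)) \<le> 1 * cost_bound"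
    unfolding norm_mult using logit_cost_le[of k "u x"] by (intro mult_mono) auto
qed

lemma excess_risk_ge:
  assumes \<Theta>: "\<Theta> \<in> centered" and "0 < \<gamma>"
    and sep: "\<And>x. x \<in> X \<Longrightarrow> \<gamma> * norm (model \<phi> \<Theta> x - P x)
        \<le> norm (opt_action c (model \<phi> \<Theta> x) - opt_action c (P x))"
    and bound: "\<And>x. x \<in> X \<Longrightarrow> infnorm (transpose \<Theta> *v \<phi> x) \<le> B"
  shows "\<mu> / 2 * \<gamma>\<^sup>2 * (exp (- 4 * B) / (real CARD('k))\<^sup>2) * logit_error Dx \<phi> \<eta> \<Theta>
    \<le> risk c D (policy c \<phi> \<Theta>) - risk c D (\<lambda>x. opt_action c (P x))"
proof -
  let ?u = "\<lambda>x. transpose \<Theta> *v \<phi> x"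
  let ?e = "exp (- 4 * B) / (real CARD('k))\<^sup>2"
  let ?F = "\<lambda>v x. \<Sum>k\<in>UNIV. P x $ k * logit_cost k (v x)"
  have pointwise: "\<mu> / 2 * \<gamma>\<^sup>2 * ?e * (norm (?u x - \<eta> x))\<^sup>2 \<le> ?F ?u x - ?F \<eta> x" if x: "x \<in> X" for x
  proof -
    \<comment> \<open>The constraint on the parameters becomes centring of the logits, the form in
      which the softmax bound requires it.\<close>
    have "?u x \<bullet> 1 = \<phi> x \<bullet> (\<Theta> *v 1)"
      using inner_outer[of \<Theta> "\<phi> x" 1]
      by (simp add: inner_vec_def matrix_vector_mult_def transpose_def sum_distrib_left sum_distrib_right mult.commute[of "\<phi> x $ _"])
        (rule sum.swap)
    then have u1: "?u x \<bullet> 1 = 0" using \<Theta> by (simp add: centered_def)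
    have "?e * (norm (?u x - \<eta> x))\<^sup>2 \<le> (norm (model \<phi> \<Theta> x - P x))\<^sup>2"
      unfolding model_def P_softmax[OF x]
      by (intro softmax_distance_ge u1 bound x eta_centered eta_bound)
    then have "\<gamma>\<^sup>2 * (?e * (norm (?u x - \<eta> x))\<^sup>2) \<le> (\<gamma> * norm (model \<phi> \<Theta> x - P x))\<^sup>2"
      unfolding power_mult_distrib by (rule mult_left_mono) simp
    also have "\<dots> \<le> (norm (opt_action c (model \<phi> \<Theta> x) - opt_action c (P x)))\<^sup>2"
      using \<open>0 < \<gamma>\<close> by (intro power_mono sep x) auto
    finally have "\<mu> / 2 * (\<gamma>\<^sup>2 * (?e * (norm (?u x - \<eta> x))\<^sup>2))
        \<le> \<mu> / 2 * (norm (opt_action c (model \<phi> \<Theta> x) - opt_action c (P x)))\<^sup>2"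
      using modulus_pos by (intro mult_left_mono) auto
    also have "\<dots> \<le> (\<Sum>k\<in>UNIV. P x $ k * (c (opt_action c (model \<phi> \<Theta> x)) k - c (opt_action c (P x)) k))"
      by (rule opt_action_gap) (simp add: P_softmax[OF x] softmax_in_simplex)
    also have "\<dots> = ?F ?u x - ?F \<eta> x"
      by (simp add: logit_cost_def model_def P_softmax[OF x] right_diff_distrib sum_subtractf)
    finally show ?thesis by (simp only: mult.assoc)
  qed
  have int: "integrable Dx (?F ?u)" "integrable Dx (?F \<eta>)"
    by (intro mixed_cost_integrable; measurable)+
  have sq: "integrable Dx (\<lambda>x. (norm (?u x - \<eta> x))\<^sup>2)"
    by (rule logit_error_integrable[OF _ eta_sq]) measurable
  have "\<mu> / 2 * \<gamma>\<^sup>2 * ?e * logit_error Dx \<phi> \<eta> \<Theta>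
      = (\<integral>x. \<mu> / 2 * \<gamma>\<^sup>2 * ?e * (norm (?u x - \<eta> x))\<^sup>2 \<partial>Dx)"
    by (simp add: logit_error_def)
  also have "\<dots> \<le> (\<integral>x. ?F ?u x - ?F \<eta> x \<partial>Dx)"
    by (intro integral_mono Bochner_Integration.integrable_mult_right sq Bochner_Integration.integrable_diff int)
      (rule pointwise, simp add: space_marginal)
  also have "\<dots> = risk c D (policy c \<phi> \<Theta>) - risk c D (\<lambda>x. opt_action c (P x))"
    unfolding risk_policy risk_optimal by (rule Bochner_Integration.integral_diff[OF int])
  finally show ?thesis .
qed

text \<open>Joint measurability of the cost in the sample and a fresh data point makes the risk of
  the random policy measurable; the cost bound, uniform in the parameters, makes it
  integrable.\<close>

lemma risk_integrable:
  assumes S: "prob_space S" and \<Theta>: "\<Theta> \<in> borel_measurable S"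
  shows "integrable S (\<lambda>s. risk c D (policy c \<phi> (\<Theta> s)))"
proof -
  interpret S: prob_space S by (rule S)
  note \<Theta>[measurable]
  have "(\<lambda>z. logit_cost (snd (snd z)) (transpose (\<Theta> (fst z)) *v \<phi> (fst (snd z)))) \<in> borel_measurable (S \<Otimes>\<^sub>M D)"
    by (rule borel_measurable_outcome[where h = "\<lambda>k z. logit_cost k (transpose (\<Theta> (fst z)) *v \<phi> (fst (snd z)))"]) measurable
  then have "(\<lambda>s. \<integral>z. logit_cost (snd z) (transpose (\<Theta> s) *v \<phi> (fst z)) \<partial>D) \<in> borel_measurable S"
    by (intro data.borel_measurable_lebesgue_integral) (simp add: case_prod_beta')
  then have meas: "(\<lambda>s. risk c D (policy c \<phi> (\<Theta> s))) \<in> borel_measurable S"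
    by (simp add: risk_def cost_policy)
  have "\<bar>risk c D (policy c \<phi> \<Theta>')\<bar> \<le> cost_bound" for \<Theta>'
  proof -
    have [measurable]: "(\<lambda>z. logit_cost (snd z) (transpose \<Theta>' *v \<phi> (fst z))) \<in> borel_measurable D"
      by (rule borel_measurable_outcome[where h = "\<lambda>k z. logit_cost k (transpose \<Theta>' *v \<phi> (fst z))"]) measurable
    have int: "integrable D (\<lambda>z. logit_cost (snd z) (transpose \<Theta>' *v \<phi> (fst z)))"
      by (rule data.integrable_const_bound[where B = cost_bound]) (use logit_cost_le in auto)
    have "\<bar>risk c D (policy c \<phi> \<Theta>')\<bar> \<le> (\<integral>z. \<bar>logit_cost (snd z) (transpose \<Theta>' *v \<phi> (fst z))\<bar> \<partial>D)"
      by (simp add: risk_def cost_policy integral_abs_bound)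
    also have "\<dots> \<le> (\<integral>z. cost_bound \<partial>D)"
      using int by (intro integral_mono integrable_abs logit_cost_le) auto
    finally show ?thesis by (simp add: data.prob_space)
  qed
  then show ?thesis
    using meas by (intro S.integrable_const_bound[where B = cost_bound]) auto
qed

text \<open>A score entry is a feature times a bounded derivative, so its square is dominated by a
  multiple of the squared feature norm.\<close>

lemma score_component_integrable:
  fixes \<Theta> :: "real^'k^'p"
  shows "integrable D (\<lambda>z. score c \<phi> \<Theta> z $ ij)" and "integrable D (\<lambda>z. (score c \<phi> \<Theta> z $ ij)\<^sup>2)"
proof -
  have comp: "score c \<phi> \<Theta> z $ ij
      = \<phi> (fst z) $ fst ij * grad (logit_cost (snd z)) (transpose \<Theta> *v \<phi> (fst z)) $ snd ij" for z
    by (simp add: score_eq vectorize_def example_grad_def outer_def)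
  have [measurable]: "(\<lambda>z. score c \<phi> \<Theta> z $ ij) \<in> borel_measurable D"
    unfolding comp
    by (rule borel_measurable_outcome[where h = "\<lambda>k z. \<phi> (fst z) $ fst ij * grad (logit_cost k) (transpose \<Theta> *v \<phi> (fst z)) $ snd ij"])
      measurable
  have sq: "integrable D (\<lambda>z. (norm (\<phi> (fst z)))\<^sup>2)"
    using phi_sq unfolding marginal_x_def by (subst (asm) integrable_distr_eq) measurable
  show *: "integrable D (\<lambda>z. (score c \<phi> \<Theta> z $ ij)\<^sup>2)"
  proof (rule Bochner_Integration.integrable_bound[OF Bochner_Integration.integrable_mult_right[OF sq, of "logit_lipschitz\<^sup>2"]])
    show "AE z in D. norm ((score c \<phi> \<Theta> z $ ij)\<^sup>2) \<le> norm (logit_lipschitz\<^sup>2 * (norm (\<phi> (fst z)))\<^sup>2)"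
    proof (rule AE_I2)
      fix z
      have "\<bar>score c \<phi> \<Theta> z $ ij\<bar> \<le> norm (\<phi> (fst z)) * logit_lipschitz"
        unfolding comp abs_mult
        by (intro mult_mono order_trans[OF component_le_norm_cart logit_cost_grad_bound] component_le_norm_cart) auto
      then have "\<bar>score c \<phi> \<Theta> z $ ij\<bar>\<^sup>2 \<le> (norm (\<phi> (fst z)) * logit_lipschitz)\<^sup>2"
        by (intro power_mono) auto
      then show "norm ((score c \<phi> \<Theta> z $ ij)\<^sup>2) \<le> norm (logit_lipschitz\<^sup>2 * (norm (\<phi> (fst z)))\<^sup>2)"
        by (simp add: power_mult_distrib mult.commute)
    qed
  qed measurable
  show "integrable D (\<lambda>z. score c \<phi> \<Theta> z $ ij)"
    by (rule data.square_integrable_imp_integrable[OF _ *]) measurable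
qed

text \<open>\<open>vectorize\<close> is an isometry, so the Frobenius norm splits into coordinates,
  whose variances add up to the trace.\<close>

lemma mean_example_grad_second_moment:
  fixes \<Theta> :: "real^'k^'p"
  assumes n: "1 \<le> n"
  defines "g \<equiv> \<lambda>s. (1 / real n) *\<^sub>R (\<Sum>i<n. example_grad \<phi> \<Theta> (s i))"
  shows "integrable (sample_space n D) (\<lambda>s. (norm (g s))\<^sup>2)"
    and "trace (covariance_matrix D (score c \<phi> \<Theta>)) * (1 / real n) \<le> (\<integral>s. (norm (g s))\<^sup>2 \<partial>sample_space n D)"
proof -
  have sq: "(norm (g s))\<^sup>2 = (\<Sum>ij\<in>UNIV. (1 / real n * (\<Sum>i<n. score c \<phi> \<Theta> (s i) $ ij))\<^sup>2)" for s
    unfolding norm_vectorize[symmetric] power2_norm_vec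
    by (simp add: g_def vectorize_def score_eq)
  note M = sample_mean_second_moment[OF data_prob score_component_integrable n]
  show "integrable (sample_space n D) (\<lambda>s. (norm (g s))\<^sup>2)"
    unfolding sq by (intro Bochner_Integration.integrable_sum M)
  have "trace (covariance_matrix D (score c \<phi> \<Theta>)) * (1 / real n)
      \<le> (\<Sum>ij\<in>UNIV. \<integral>s. (1 / real n * (\<Sum>i<n. score c \<phi> \<Theta> (s i) $ ij))\<^sup>2 \<partial>sample_space n D)"
    unfolding trace_def sum_distrib_right covariance_matrix_def vec_lambda_beta
    by (intro sum_mono M)
  also have "\<dots> = (\<integral>s. (norm (g s))\<^sup>2 \<partial>sample_space n D)"
    unfolding sq by (rule Bochner_Integration.integral_sum[symmetric]) (rule M)
  finally show "trace (covariance_matrix D (score c \<phi> \<Theta>)) * (1 / real n) \<le> (\<integral>s. (norm (g s))\<^sup>2 \<partial>sample_space n D)" .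
qed

text \<open>Scores are outer products with the feature vector. This settles the case in which
  \<open>min_pos_eigenvalue\<close> is the minimum of an empty set and its value is unknown.\<close>

lemma degenerate_covariance:
  fixes \<Theta> :: "real^'k^'p"
  assumes "AE x in Dx. \<phi> x = 0"
  shows "trace (covariance_matrix D (score c \<phi> \<Theta>)) = 0"
proof -
  have "AE z in D. \<phi> (fst z) = 0"
    using assms unfolding marginal_x_def by (rule AE_distrD[rotated]) measurable
  then have zero: "AE z in D. score c \<phi> \<Theta> z $ ij = 0" for ij
    by eventually_elim (simp add: score_eq example_grad_def outer_def vectorize_def)
  have mean: "(\<integral>z. score c \<phi> \<Theta> z $ ij \<partial>D) = 0" for ij
    by (rule integral_eq_zero_AE[OF zero])
  have "(\<integral>z. score c \<phi> \<Theta> z $ ij * score c \<phi> \<Theta> z $ ij \<partial>D) = 0" for ij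
    by (rule integral_eq_zero_AE) (use zero[of ij] in eventually_elim, simp)
  then show ?thesis by (simp add: trace_def covariance_matrix_def mean)
qed

end

theorem theorem2:
  fixes X :: "(real^'x) set"
    and D :: "((real^'x) \<times> 'k::finite) measure"
    and c :: "real^'d \<Rightarrow> 'k \<Rightarrow> real"
    and Pstar \<eta> :: "real^'x \<Rightarrow> real^'k"
    and \<phi> :: "real^'x \<Rightarrow> real^'p"
    and n :: nat
    and \<Theta>hat :: "(nat \<Rightarrow> (real^'x) \<times> 'k) \<Rightarrow> real^'k^'p"
    and \<Theta>star :: "real^'k^'p"
    and \<mu> L G \<gamma> B L\<^sub>H :: real
  defines "Dx \<equiv> marginal_x X D"
    and "S \<equiv> sample_space n D"
  \<comment> \<open>data distribution, features and sample size\<close>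
  assumes D_prob: "prob_space D"
    and D_sets: "sets D = sets (context_space X \<Otimes>\<^sub>M count_space UNIV)"
    and cond_law: "conditional_law X D Pstar"
    and \<phi>_meas: "\<phi> \<in> borel_measurable (context_space X)"
    and \<phi>_sq: "integrable Dx (\<lambda>x. (norm (\<phi> x))\<^sup>2)"
    and n_pos: "n \<ge> 1"
  \<comment> \<open>strong-only estimator and best logit approximation\<close>
    and \<Theta>hat_meas: "\<Theta>hat \<in> borel_measurable S"
    and \<Theta>hat_min: "AE s in S. is_arg_min (empirical_risk c \<phi> n s) (\<lambda>\<Theta>. \<Theta> \<in> centered) (\<Theta>hat s)"
    and \<Theta>star_min: "is_arg_min (logit_error Dx \<phi> \<eta>) (\<lambda>\<Theta>. \<Theta> \<in> centered) \<Theta>star"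
  \<comment> \<open>realizability\<close>
    and \<eta>_meas: "\<eta> \<in> borel_measurable (context_space X)"
    and realizable: "\<forall>x\<in>X. \<forall>k. Pstar x $ k = softmax (\<eta> x) $ k"
    and \<eta>_centered: "\<forall>x\<in>X. \<eta> x \<bullet> 1 = 0"
    and \<eta>_moment: "integrable Dx (\<lambda>x. norm (\<eta> x) ^ 4)"
  \<comment> \<open>cost regularity\<close>
    and \<mu>_pos: "0 < \<mu>" and \<mu>_le_L: "\<mu> \<le> L"
    and cost_hessian: "\<forall>a k. \<exists>H. has_hessian (\<lambda>a. c a k) H a \<and>
          loewner_le (\<lambda>v. \<mu> *\<^sub>R v) H \<and> loewner_le H (\<lambda>v. L *\<^sub>R v)"
    and cost_grad: "\<forall>a \<in> convex hull (opt_action c ` prob_simplex). \<forall>k.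
          norm (grad (\<lambda>a. c a k) a) \<le> G"
  \<comment> \<open>action separation and bounded logits\<close>
    and \<gamma>_pos: "0 < \<gamma>"
    and separation: "AE s in S. \<forall>x\<in>X.
          norm (opt_action c (model \<phi> (\<Theta>hat s) x) - opt_action c (Pstar x))
            \<ge> \<gamma> * norm (model \<phi> (\<Theta>hat s) x - Pstar x)"
    and B_pos: "0 < B"
    and logit_bound: "AE s in S. \<forall>x\<in>X. infnorm (transpose (\<Theta>hat s) *v \<phi> x) \<le> B"
    and \<eta>_bound: "\<forall>x\<in>X. infnorm (\<eta> x) \<le> B"
  \<comment> \<open>smoothness of the empirical risk\<close>
    and L\<^sub>H_pos: "0 < L\<^sub>H"
    and risk_hessian: "AE s in S. \<forall>\<Theta> \<in> closed_segment \<Theta>star (\<Theta>hat s).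
          \<exists>H. has_hessian (empirical_risk c \<phi> n s) H \<Theta> \<and>
            loewner_le (\<lambda>V. (- L\<^sub>H) *\<^sub>R V) H \<and> loewner_le H (\<lambda>V. L\<^sub>H *\<^sub>R V)"
  shows "0 < C\<^sub>0 \<and>
    (\<integral>s. risk c D (policy c \<phi> (\<Theta>hat s)) - risk c D (\<lambda>x. opt_action c (Pstar x)) \<partial>S)
      \<ge> C\<^sub>0 * \<mu> * \<gamma>\<^sup>2 * (exp (- 4 * B) / (real CARD('k))\<^sup>2) *
         (approx_error Dx \<phi> \<eta>
          + min_pos_eigenvalue (second_moment Dx \<phi>)
            * trace (covariance_matrix D (score c \<phi> \<Theta>star)) / L\<^sub>H\<^sup>2 * (1 / real n))"
proof -
  interpret decision_problem c \<mu> G X D Pstar \<eta> \<phi> B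
  proof (rule decision_problem.intro)
    show "convex_cost c \<mu> G"
      using \<mu>_pos cost_hessian cost_grad by (intro convex_cost.intro) blast+
    show "decision_problem_axioms X D Pstar \<eta> \<phi> B"
      using D_prob D_sets cond_law \<phi>_meas \<phi>_sq \<eta>_meas realizable \<eta>_centered \<eta>_bound
      unfolding Dx_def by (intro decision_problem_axioms.intro) (auto simp: vec_eq_iff)
  qed
  have S: "prob_space S"
    unfolding S_def sample_space_def by (intro prob_space_PiM D_prob)
  interpret S: prob_space S by (rule S)
  define \<kappa> where "\<kappa> = \<mu> / 2 * \<gamma>\<^sup>2 * (exp (- 4 * B) / (real CARD('k))\<^sup>2)"
  have \<kappa>: "0 \<le> \<kappa>" using \<mu>_pos by (simp add: \<kappa>_def)
  define excess where
    "excess s = risk c D (policy c \<phi> (\<Theta>hat s)) - risk c D (\<lambda>x. opt_action c (Pstar x))" for s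
  define g where "g s = (1 / real n) *\<^sub>R (\<Sum>i<n. example_grad \<phi> \<Theta>star (s i))" for s
  let ?\<rho> = "approx_error Dx \<phi> \<eta>" and ?l = "min_pos_eigenvalue (second_moment Dx \<phi>)"
    and ?tr = "trace (covariance_matrix D (score c \<phi> \<Theta>star))"
  \<comment> \<open>Monotonicity of Bochner integrals needs this, since a non-integrable function
    has integral 0 by convention.\<close>
  have excess_int: "integrable S excess"
    unfolding excess_def by (intro Bochner_Integration.integrable_diff risk_integrable[OF S \<Theta>hat_meas]) simp
  have excess_ge: "AE s in S. \<kappa> * (?\<rho> + (\<integral>x. (norm (transpose (\<Theta>hat s - \<Theta>star) *v \<phi> x))\<^sup>2 \<partial>Dx)) \<le> excess s"
    using \<Theta>hat_min separation logit_bound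
  proof eventually_elim
    case (elim s)
    then have centered: "\<Theta>hat s \<in> centered" by (simp add: is_arg_min_linorder)
    have "\<kappa> * (?\<rho> + (\<integral>x. (norm (transpose (\<Theta>hat s - \<Theta>star) *v \<phi> x))\<^sup>2 \<partial>Dx)) \<le> \<kappa> * logit_error Dx \<phi> \<eta> (\<Theta>hat s)"
      using \<Theta>star_min unfolding Dx_def
      by (intro mult_left_mono logit_error_ge eta_sq centered \<kappa>) measurable
    also have "\<dots> \<le> excess s"
      unfolding \<kappa>_def excess_def Dx_def using elim \<gamma>_pos by (intro excess_risk_ge centered) auto
    finally show ?case .
  qed
  \<comment> \<open>The case distinction asks whether some nonzero vector is orthogonal to the
    kernel of the feature second moment, that is, whether a positive eigenvalue exists.\<close>
  have "\<kappa> * (?\<rho> + ?l * ?tr / L\<^sub>H\<^sup>2 * (1 / real n)) \<le> (\<integral>s. excess s \<partial>S)"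
  proof (cases "\<exists>u. u \<noteq> 0 \<and> (\<forall>v. second_moment Dx \<phi> *v v = 0 \<longrightarrow> u \<bullet> v = 0)")
    case True
    note nontrivial = this[unfolded Dx_def]
    have scale: "?l * ?tr / L\<^sub>H\<^sup>2 * (1 / real n) = ?l * (?tr * (1 / real n) / L\<^sub>H\<^sup>2)"
      by (simp add: mult.commute)
    have l: "0 < ?l"
      unfolding Dx_def
      by (rule min_pos_eigenvalue_le(1)[OF second_moment_symmetric second_moment_psd nontrivial])
    have "AE z in D. \<forall>v. \<Sigma> *v v = 0 \<longrightarrow> v \<bullet> \<phi> (fst z) = 0"
      using features_orthogonal_kernel unfolding marginal_x_def[of X D] by (rule AE_distrD[rotated]) measurable
    \<comment> \<open>Each sample coordinate has law \<open>D\<close>, so the exceptional set of one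
      data point pulls back to a null set of samples for each \<open>i < n\<close>.\<close>
    then have "AE s in S. \<forall>v. \<Sigma> *v v = 0 \<longrightarrow> v \<bullet> \<phi> (fst (s i)) = 0" if "i < n" for i
      unfolding S_def sample_space_def using that D_prob by (intro AE_PiM_component) auto
    then have "AE s in S. \<forall>i\<in>{..<n}. \<forall>v. \<Sigma> *v v = 0 \<longrightarrow> v \<bullet> \<phi> (fst (s i)) = 0"
      by (subst AE_finite_all) auto
    then have "AE s in S. \<kappa> * (?\<rho> + ?l * ((norm (g s))\<^sup>2 / L\<^sub>H\<^sup>2)) \<le> excess s"
      using \<Theta>hat_min risk_hessian excess_ge
    proof eventually_elim
      case (elim s)
      obtain Y Z where YZ: "\<Theta>hat s - \<Theta>star = Y + Z" "\<And>k. column k Z \<in> {v. \<Sigma> *v v = 0}"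
        "\<And>k v. v \<in> {v. \<Sigma> *v v = 0} \<Longrightarrow> column k Y \<bullet> v = 0"
        using matrix_column_decomposition[OF kernel_subspace] by blast
      have invisible: "transpose Z *v \<phi> (fst (s i)) = 0" if "i < n" for i
        using elim(1) YZ(2) that by (simp add: vec_eq_iff transpose_mult_nth)
      have "norm (g s) \<le> L\<^sub>H * norm Y"
        unfolding g_def by (rule empirical_gradient_bound[OF _ elim(2) YZ(1) invisible]) (use elim(3) in blast)
      then have "(norm (g s))\<^sup>2 \<le> (L\<^sub>H * norm Y)\<^sup>2" by (intro power_mono) auto
      then have "(norm (g s))\<^sup>2 / L\<^sub>H\<^sup>2 \<le> (norm Y)\<^sup>2"
        using L\<^sub>H_pos by (simp add: field_simps power_mult_distrib)
      then have "?l * ((norm (g s))\<^sup>2 / L\<^sub>H\<^sup>2) \<le> ?l * (norm Y)\<^sup>2"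
        using l by (intro mult_left_mono) auto
      also have "\<dots> \<le> (\<integral>x. (norm (transpose (\<Theta>hat s - \<Theta>star) *v \<phi> x))\<^sup>2 \<partial>Dx)"
        unfolding YZ(1) Dx_def using YZ(2,3) by (intro logit_integral_ge nontrivial) auto
      finally have "\<kappa> * (?\<rho> + ?l * ((norm (g s))\<^sup>2 / L\<^sub>H\<^sup>2))
          \<le> \<kappa> * (?\<rho> + (\<integral>x. (norm (transpose (\<Theta>hat s - \<Theta>star) *v \<phi> x))\<^sup>2 \<partial>Dx))"
        using \<kappa> by (intro mult_left_mono) auto
      with elim(4) show ?case by linarith
    qed
    moreover have g_int: "integrable S (\<lambda>s. (norm (g s))\<^sup>2)"
      unfolding S_def g_def by (rule mean_example_grad_second_moment(1)[OF n_pos])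
    ultimately have "(\<integral>s. \<kappa> * (?\<rho> + ?l * ((norm (g s))\<^sup>2 / L\<^sub>H\<^sup>2)) \<partial>S) \<le> (\<integral>s. excess s \<partial>S)"
      using excess_int by (intro integral_mono_AE) auto
    moreover have "(\<integral>s. \<kappa> * (?\<rho> + ?l * ((norm (g s))\<^sup>2 / L\<^sub>H\<^sup>2)) \<partial>S)
        = \<kappa> * (?\<rho> + ?l * ((\<integral>s. (norm (g s))\<^sup>2 \<partial>S) / L\<^sub>H\<^sup>2))"
      using g_int by (simp add: S.prob_space)
    moreover have "?tr * (1 / real n) \<le> (\<integral>s. (norm (g s))\<^sup>2 \<partial>S)"
      unfolding S_def g_def by (rule mean_example_grad_second_moment(2)[OF n_pos])
    then have "\<kappa> * (?\<rho> + ?l * (?tr * (1 / real n) / L\<^sub>H\<^sup>2))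
        \<le> \<kappa> * (?\<rho> + ?l * ((\<integral>s. (norm (g s))\<^sup>2 \<partial>S) / L\<^sub>H\<^sup>2))"
      using l \<kappa> by (intro mult_left_mono add_left_mono divide_right_mono) auto
    ultimately show ?thesis unfolding scale by linarith
  next
    case False
    \<comment> \<open>Almost every feature vector is itself orthogonal to the kernel, and in this
      case only 0 is.\<close>
    have "AE x in Dx. \<phi> x = 0"
      unfolding Dx_def using features_orthogonal_kernel
    proof eventually_elim
      case (elim x)
      then show ?case using False unfolding Dx_def by (metis inner_commute)
    qed
    then have "?tr = 0" unfolding Dx_def by (rule degenerate_covariance)
    moreover have "(\<integral>s. \<kappa> * ?\<rho> \<partial>S) \<le> (\<integral>s. excess s \<partial>S)"
    proof (rule integral_mono_AE[OF _ excess_int])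
      show "AE s in S. \<kappa> * ?\<rho> \<le> excess s"
        using excess_ge
      proof eventually_elim
        case (elim s)
        have "\<kappa> * ?\<rho> \<le> \<kappa> * (?\<rho> + (\<integral>x. (norm (transpose (\<Theta>hat s - \<Theta>star) *v \<phi> x))\<^sup>2 \<partial>Dx))"
          using \<kappa> by (intro mult_left_mono) auto
        with elim show ?case by linarith
      qed
    qed simp
    ultimately show ?thesis by (simp add: S.prob_space)
  qed
  moreover have "C\<^sub>0 * \<mu> * \<gamma>\<^sup>2 * (exp (- 4 * B) / (real CARD('k))\<^sup>2) = \<kappa>"
    by (simp add: \<kappa>_def C\<^sub>0_def)
  ultimately show ?thesis
    unfolding excess_def by (simp only: C\<^sub>0_def) simp
qed

end
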